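(* For $0<\sigma_1\le\sigma_2<\infty$ write $R=\sigma_2/\sigma_1$ and let $\mathcal{P}_2^{[\sigma_1^2,\sigma_2^2]}$ be the class of all probability distributions $P$ on $\mathbb{R}$ with finite second moment and $\sigma_1^2\le\sigma_P^2\le\sigma_2^2$. 1. Let $0<\sigma_1<\sigma_2<\infty$, $L^{(1)}=(4e\sqrt{2+4\ln 2})\,R$ and $\delta^{(1)}_{\min}=4e^{1-n/2}$. For every integer $n\ge 6$ there exists a multiple-$\delta$ $L^{(1)}$-sub-Gaussian estimator for $(\mathcal{P}_2^{[\sigma_1^2,\sigma_2^2]},n,\delta^{(1)}_{\min})$. 2. For any $L\ge\sqrt{2}$ there exist $\phi^{(2)}>0$ and $\delta^{(2)}_{\min}>0$, depending only on $L$, such that, for all $0<\sigma_1<\sigma_2<\infty$ with $R>\phi^{(2)}$, there is no multiple-$\delta$ $L$-sub-Gaussian estimator for $(\mathcal{P}_2^{[\sigma_1^2,\sigma_2^2]},n,\delta^{(2)}_{\min})$ for any positive integer $n$. 3. For any $0<\sigma_1\le\sigma_2<\infty$ (i.e. any value of $R\ge 1$) and any $L\ge\sqrt{2}$, if $\delta^{(3)}_{\min}=e^{1-5L^2n}$, there is no $\delta$-dependent $L$-sub-Gaussian estimator for $(\mathcal{P}_2^{[\sigma_1^2,\sigma_2^2]},n,\delta^{(3)}_{\min})$ for any positive integer $n$.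
   Context: For a distribution $P$ on $\mathbb{R}$ with finite second moment, $\mu_P$ and $\sigma_P^2$ denote its mean and variance. Let $n$ be a positive integer, $L>0$, $\delta_{\min}\in(0,1)$, and $\mathcal{P}$ a family of probability distributions on $\mathbb{R}$ with finite second moments. A $\delta$-dependent $L$-sub-Gaussian estimator for $(\mathcal{P},n,\delta_{\min})$ is a measurable map $\widehat{E}_n:\mathbb{R}^n\times[\delta_{\min},1)\to\mathbb{R}$ such that for all $P\in\mathcal{P}$ and $\delta\in[\delta_{\min},1)$, if $X_1^n=(X_1,\dots,X_n)$ is an i.i.d. sample from $P$, then $\mathbb{P}\left(|\widehat{E}_n(X_1^n,\delta)-\mu_P|>L\,\sigma_P\sqrt{\frac{1+\ln(1/\delta)}{n}}\right)\le\delta$. A multiple-$\delta$ $L$-sub-Gaussian estimator for $(\mathcal{P},n,\delta_{\min})$ is a measurable map $\widehat{E}_n:\mathbb{R}^n\to\mathbb{R}$ (not depending on $\delta$) such that for all $\delta\in[\delta_{\min},1)$, $P\in\mathcal{P}$ and i.i.d. samples $X_1^n$ from $P$, $\mathbb{P}\left(|\widehat{E}_n(X_1^n)-\mu_P|>L\,\sigma_P\sqrt{\frac{1+\ln(1/\delta)}{n}}\right)\le\delta$. *)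

theory Defs
  imports "HOL-Probability.Probability"
begin

definition dist_mean :: "real measure \<Rightarrow> real" where
  "dist_mean P = (\<integral>x. x \<partial>P)"

definition dist_variance :: "real measure \<Rightarrow> real" where
  "dist_variance P = (\<integral>x. (x - dist_mean P)\<^sup>2 \<partial>P)"

definition dist_sd :: "real measure \<Rightarrow> real" where
  "dist_sd P = sqrt (dist_variance P)"

text \<open>
  A point of \<open>\<real>\<^sup>n\<close> is an (extensional) function on the index set \<open>{..<n}\<close>, so that the
  dimension can be quantified. The sigma-algebra is the Borel one.
\<close>

abbreviation real_pow :: "nat \<Rightarrow> (nat \<Rightarrow> real) measure" where
  "real_pow n \<equiv> PiM {..<n} (\<lambda>_. borel :: real measure)"

text \<open>
  The law of an i.i.d. sample of size \<open>n\<close> from \<open>P\<close>; see \<open>distr_iid_sample\<close> below.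
\<close>

definition iid_law :: "real measure \<Rightarrow> nat \<Rightarrow> (nat \<Rightarrow> real) measure" where
  "iid_law P n = PiM {..<n} (\<lambda>_. P)"

lemma (in prob_space) distr_iid_sample:
  fixes X :: "nat \<Rightarrow> 'a \<Rightarrow> real"
  assumes "n > 0"
    and "indep_vars (\<lambda>_. borel) X {..<n}"
    and "\<And>i. i < n \<Longrightarrow> distr M borel (X i) = P"
  shows "distr M (real_pow n) (\<lambda>\<omega>. \<lambda>i\<in>{..<n}. X i \<omega>) = iid_law P n"
proof -
  have rv: "random_variable borel (X i)" if "i \<in> {..<n}" for i
    using assms(2) that unfolding indep_vars_def by auto
  have "distr M (real_pow n) (\<lambda>\<omega>. \<lambda>i\<in>{..<n}. X i \<omega>) = PiM {..<n} (\<lambda>i. distr M borel (X i))"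
    using assms(1,2) indep_vars_iff_distr_eq_PiM'[of "{..<n}" X "\<lambda>_. borel"] rv by auto
  also have "\<dots> = iid_law P n"
    unfolding iid_law_def by (rule PiM_cong) (use assms(3) in auto)
  finally show ?thesis .
qed

text \<open>
  The two predicates below are meant for \<open>n > 0\<close>, \<open>L > 0\<close> and \<open>0 < \<delta>\<^sub>m\<^sub>i\<^sub>n < 1\<close>.
  These side conditions are deliberately not part of the predicates: otherwise a non-existence
  claim would hold vacuously as soon as one of them fails.
\<close>

definition delta_dependent_sub_Gaussian_estimator ::
  "real \<Rightarrow> real measure set \<Rightarrow> nat \<Rightarrow> real \<Rightarrow> ((nat \<Rightarrow> real) \<times> real \<Rightarrow> real) \<Rightarrow> bool" where
  "delta_dependent_sub_Gaussian_estimator L \<P> n \<delta>min E \<longleftrightarrow>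
     E \<in> borel_measurable (real_pow n \<Otimes>\<^sub>M restrict_space borel {\<delta>min..<1}) \<and>
     (\<forall>P\<in>\<P>. \<forall>\<delta>\<in>{\<delta>min..<1}.
        measure (iid_law P n)
          {x \<in> space (iid_law P n).
             \<bar>E (x, \<delta>) - dist_mean P\<bar> > L * dist_sd P * sqrt ((1 + ln (1 / \<delta>)) / real n)} \<le> \<delta>)"

definition multiple_delta_sub_Gaussian_estimator ::
  "real \<Rightarrow> real measure set \<Rightarrow> nat \<Rightarrow> real \<Rightarrow> ((nat \<Rightarrow> real) \<Rightarrow> real) \<Rightarrow> bool" where
  "multiple_delta_sub_Gaussian_estimator L \<P> n \<delta>min E \<longleftrightarrow>
     E \<in> borel_measurable (real_pow n) \<and>
     (\<forall>\<delta>\<in>{\<delta>min..<1}. \<forall>P\<in>\<P>.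
        measure (iid_law P n)
          {x \<in> space (iid_law P n).
             \<bar>E x - dist_mean P\<bar> > L * dist_sd P * sqrt ((1 + ln (1 / \<delta>)) / real n)} \<le> \<delta>)"

text \<open>The class \<open>\<P>\<^sub>2\<close> with variances in \<open>[a, b]\<close>.\<close>

definition var_class :: "real \<Rightarrow> real \<Rightarrow> real measure set" where
  "var_class a b =
     {P. real_distribution P \<and> integrable P (\<lambda>x. x\<^sup>2) \<and> a \<le> dist_variance P \<and> dist_variance P \<le> b}"

end

theory Submission
  imports Defs "HOL-Real_Asymp.Real_Asymp"
begin

text \<open>
  The positive part combines median-of-means estimators for the error probabilities \<open>2^-k\<close>. Each
  one has sub-Gaussian deviations (\<open>median_of_means_deviation\<close>): by Chebyshev's inequality a single
  block mean rarely deviates, and half of the independent blocks deviate together only with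
  exponentially small probability. As the standard deviation is at most \<open>\<sigma>2\<close>, every such estimator
  comes with a confidence interval of known radius. Intersecting the intervals from the most
  reliable one downwards for as long as the intersection is nonempty (\<open>intersect_intervals_close\<close>)
  yields a point that is good at all confidence levels simultaneously.

  Both negative parts use two-point distributions on \<open>0\<close> and \<open>a\<close>.

  For \<open>\<delta>\<close>-dependent estimators (\<open>no_delta_dependent_estimator\<close>), two distributions that are
  mirror images of each other share the all-zero sample, whose probability still exceeds the
  required error probability although the two means are too far apart for one estimate.

  For a single estimator (\<open>no_multiple_delta_estimator\<close>), precision under a low-variance
  distribution at a very small but fixed error probability \<open>\<delta>min\<close> forces the estimate to be close
  to the mean of that distribution on typical samples of a high-variance distribution as well,
  because the likelihood ratio between the two is bounded there. The high-variance
  distribution has a different mean, so the estimator fails for it with a probability that is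
  bounded below uniformly in the sample size. An estimator that knows \<open>\<delta>\<close> escapes this argument, since it
  may answer differently at the two confidence levels involved.
\<close>

section \<open>Two-point distributions\<close>

definition two_point :: "real \<Rightarrow> real \<Rightarrow> real measure" where
  "two_point a p = distr (measure_pmf (bernoulli_pmf p)) borel (\<lambda>b. if b then a else 0)"

text \<open>
  An i.i.d. sample from a two-point distribution is the image under \<open>flips_sample\<close> of independent
  coin flips. Every probability about such a sample thus becomes one about a probability mass
  function with finite support, where likelihood ratios can be bounded point by point.
\<close>
abbreviation coin_flips :: "nat \<Rightarrow> real \<Rightarrow> (nat \<Rightarrow> bool) pmf" where
  "coin_flips n p \<equiv> Pi_pmf {..<n} False (\<lambda>_. bernoulli_pmf p)"

definition flips_sample :: "nat \<Rightarrow> real \<Rightarrow> (nat \<Rightarrow> bool) \<Rightarrow> nat \<Rightarrow> real" where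
  "flips_sample n a \<omega> = (\<lambda>i\<in>{..<n}. if \<omega> i then a else 0)"

lemma integral_two_point:
  fixes f :: "real \<Rightarrow> real"
  assumes "0 \<le> p" "p \<le> 1" and [measurable]: "f \<in> borel_measurable borel"
  shows "integral\<^sup>L (two_point a p) f = p * f a + (1 - p) * f 0"
  using assms by (simp add: two_point_def integral_distr mult.commute)

lemma dist_mean_two_point:
  assumes "0 \<le> p" "p \<le> 1"
  shows "dist_mean (two_point a p) = p * a"
  using assms by (simp add: dist_mean_def integral_two_point)

lemma dist_variance_two_point:
  assumes "0 \<le> p" "p \<le> 1"
  shows "dist_variance (two_point a p) = a\<^sup>2 * (p * (1 - p))"
  using assms unfolding dist_variance_def
  by (simp add: integral_two_point dist_mean_two_point algebra_simps power2_eq_square)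

lemma two_point_in_var_class:
  assumes "0 \<le> p" "p \<le> 1" "v \<le> a\<^sup>2 * (p * (1 - p))" "a\<^sup>2 * (p * (1 - p)) \<le> w"
  shows "two_point a p \<in> var_class v w"
proof -
  have "real_distribution (two_point a p)"
    unfolding two_point_def by (intro prob_space.real_distribution_distr measure_pmf.prob_space_axioms) simp
  moreover have "integrable (two_point a p) (\<lambda>x. x\<^sup>2)"
    unfolding two_point_def by (subst integrable_distr_eq) (auto intro: integrable_measure_pmf_finite)
  ultimately show ?thesis
    using assms by (simp add: var_class_def dist_variance_two_point)
qed

lemma iid_law_two_point:
  assumes "n > 0"
  shows "iid_law (two_point a p) n = distr (coin_flips n p) (real_pow n) (flips_sample n a)"
proof -
  have "prob_space.indep_vars (coin_flips n p) (\<lambda>_. count_space UNIV) (\<lambda>i \<omega>. \<omega> i) {..<n}"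
    by (rule indep_vars_Pi_pmf) simp
  hence "prob_space.indep_vars (coin_flips n p) (\<lambda>_. borel) (\<lambda>i \<omega>. if \<omega> i then a else 0) {..<n}"
    by (rule prob_space.indep_vars_compose2[OF measure_pmf.prob_space_axioms]) simp
  moreover have "distr (coin_flips n p) borel (\<lambda>\<omega>. if \<omega> i then a else 0) = two_point a p" if "i < n" for i
  proof -
    have "two_point a p = distr (map_pmf (\<lambda>\<omega>. \<omega> i) (coin_flips n p)) borel (\<lambda>b. if b then a else 0)"
      using that by (simp add: two_point_def Pi_pmf_component)
    thus ?thesis by (simp add: map_pmf_rep_eq distr_distr comp_def)
  qed
  ultimately show ?thesis
    using prob_space.distr_iid_sample[OF measure_pmf.prob_space_axioms assms, of "coin_flips n p" "\<lambda>i \<omega>. if \<omega> i then a else 0"]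
    by (simp add: flips_sample_def[abs_def])
qed

lemma flips_sample_space [simp]: "flips_sample n a \<omega> \<in> space (real_pow n)"
  by (auto simp: flips_sample_def space_PiM)

lemma measure_iid_law_two_point:
  assumes "n > 0" "Measurable.pred (real_pow n) Q"
  shows "measure (iid_law (two_point a p) n) {x \<in> space (iid_law (two_point a p) n). Q x} =
         measure_pmf.prob (coin_flips n p) {\<omega>. Q (flips_sample n a \<omega>)}"
proof -
  have "{x \<in> space (real_pow n). Q x} \<in> sets (real_pow n)"
    using assms(2) by simp
  moreover have "flips_sample n a -` {x \<in> space (real_pow n). Q x} = {\<omega>. Q (flips_sample n a \<omega>)}"
    by auto
  ultimately show ?thesis
    unfolding iid_law_two_point[OF assms(1)] by (simp add: measure_distr)
qed

lemma prob_no_success: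
  assumes "0 \<le> p" "p \<le> 1"
  shows "pmf (coin_flips n p) (\<lambda>_. False) = (1 - p) ^ n"
  using assms by (subst pmf_Pi') auto

lemma finite_set_pmf_coin_flips: "finite (set_pmf (coin_flips n p))"
proof -
  have "set_pmf (coin_flips n p) \<subseteq> PiE_dflt {..<n} False (\<lambda>_. UNIV)"
    using set_Pi_pmf_subset[of "{..<n}" False "\<lambda>_. bernoulli_pmf p"] by (auto simp: PiE_dflt_def)
  thus ?thesis by (rule finite_subset) (intro finite_PiE_dflt, auto)
qed

text \<open>
  Markov's inequality for the number of successes. The bound depends on \<open>n\<close> only through \<open>n p\<close>,
  so for \<open>p\<close> of order \<open>1/n\<close> it is uniform in the sample size.
\<close>
lemma expected_successes_tail:
  assumes "0 \<le> p" "p \<le> 1" "c > 0"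
  shows "measure_pmf.prob (coin_flips n p) {\<omega>. c \<le> real (card {i. i < n \<and> \<omega> i})} \<le> real n * p / c"
proof -
  let ?S = "\<lambda>\<omega>. real (card {i. i < n \<and> \<omega> i})"
  have eq: "?S \<omega> = (\<Sum>i<n. of_bool (\<omega> i))" for \<omega>
    by (auto simp: sum.If_cases Int_def of_bool_def)
  have "measure_pmf.expectation (coin_flips n p) (\<lambda>\<omega>. of_bool (\<omega> i)) = p" if "i < n" for i
  proof -
    have "map_pmf (\<lambda>\<omega>. \<omega> i) (coin_flips n p) = bernoulli_pmf p"
      using that by (simp add: Pi_pmf_component)
    with integral_map_pmf[of "\<lambda>\<omega>. \<omega> i" "coin_flips n p" "of_bool :: bool \<Rightarrow> real"]
    show ?thesis using assms by simp
  qed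
  hence "measure_pmf.expectation (coin_flips n p) ?S = n * p"
    unfolding eq
    by (subst Bochner_Integration.integral_sum)
       (auto intro: integrable_measure_pmf_finite finite_set_pmf_coin_flips)
  moreover have "measure_pmf.prob (coin_flips n p) {\<omega> \<in> space (coin_flips n p). c \<le> ?S \<omega>} \<le>
      measure_pmf.expectation (coin_flips n p) ?S / c"
    by (rule integral_Markov_inequality_measure[where A = "{}"])
       (auto intro: integrable_measure_pmf_finite finite_set_pmf_coin_flips assms)
  ultimately show ?thesis by simp
qed

text \<open>
  Raising the success probability from \<open>p\<close> to \<open>q \<le> r p\<close> multiplies the likelihood by at most \<open>r\<close>
  for each success, and failures only become less likely. On samples with few successes the
  likelihood ratio is therefore bounded independently of \<open>n\<close>.
\<close>
lemma pmf_coin_flips_le: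
  assumes "0 \<le> p" "p \<le> q" "q \<le> 1" "q \<le> r * p" "1 \<le> r"
    and "real (card {i. i < n \<and> \<omega> i}) \<le> m"
  shows "pmf (coin_flips n q) \<omega> \<le> r powr m * pmf (coin_flips n p) \<omega>"
proof (cases "\<forall>x. x \<notin> {..<n} \<longrightarrow> \<omega> x = False")
  case True
  have eq: "pmf (coin_flips n s) \<omega> = (\<Prod>i<n. if \<omega> i then s else 1 - s)" if "0 \<le> s" "s \<le> 1" for s
    using True that by (subst pmf_Pi') (auto intro!: prod.cong)
  have "pmf (coin_flips n q) \<omega> = (\<Prod>i<n. if \<omega> i then q else 1 - q)"
    using assms by (intro eq) auto
  also have "\<dots> \<le> (\<Prod>i<n. (if \<omega> i then r else 1) * (if \<omega> i then p else 1 - p))"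
    using assms by (intro prod_mono) auto
  also have "\<dots> = (\<Prod>i<n. if \<omega> i then r else 1) * pmf (coin_flips n p) \<omega>"
    using assms by (simp add: prod.distrib eq)
  also have "(\<Prod>i<n. if \<omega> i then r else 1) = r ^ card {i. i < n \<and> \<omega> i}"
    by (simp add: prod.If_cases Int_def)
  also have "\<dots> \<le> r powr m"
    using assms by (subst powr_realpow[symmetric]) (auto intro: powr_mono)
  finally show ?thesis by (simp add: mult_right_mono)
next
  case False
  thus ?thesis by (subst (1 2) pmf_Pi) auto
qed

text \<open>
  Change of measure: an event that is rare under \<open>p\<close> stays rare under \<open>q\<close>, apart from the part of
  it on which the likelihood ratio is out of control.
\<close>
lemma prob_le_if_pmf_le:
  assumes "finite (set_pmf q)" "\<And>x. x \<in> B \<Longrightarrow> pmf q x \<le> \<rho> * pmf p x" "0 \<le> \<rho>"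
  shows "measure_pmf.prob q (A \<inter> B) \<le> \<rho> * measure_pmf.prob p A"
proof -
  let ?C = "A \<inter> B \<inter> set_pmf q"
  have "measure_pmf.prob q (A \<inter> B) = (\<Sum>x\<in>?C. pmf q x)"
    using assms by (simp add: measure_Int_set_pmf flip: measure_measure_pmf_finite)
  also have "\<dots> \<le> (\<Sum>x\<in>?C. \<rho> * pmf p x)"
    using assms by (intro sum_mono) auto
  also have "\<dots> = \<rho> * measure_pmf.prob p ?C"
    using assms by (simp add: measure_measure_pmf_finite sum_distrib_left)
  also have "\<dots> \<le> \<rho> * measure_pmf.prob p A"
    using assms by (intro mult_left_mono measure_pmf.finite_measure_mono) auto
  finally show ?thesis .
qed

section \<open>Error probabilities that decay exponentially with rate \<open>5L\<^sup>2\<close>\<close>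

text \<open>
  The distributions \<open>two_point a p\<close> and \<open>two_point (-a) p\<close> have the opposite means \<open>\<plusminus>p a\<close> and both
  produce the all-zero sample with probability \<open>(1 - p)^n\<close>. If this exceeds \<open>\<delta>\<close>, the estimate at the
  all-zero sample must be within the confidence radius of both means, which is impossible when
  \<open>p a\<close> exceeds the radius. At fixed variance, moving \<open>p\<close> towards \<open>1\<close> separates the means; the
  price is that \<open>(1 - p)^n\<close> falls to the \<open>n\<close>-th power of \<open>1 / (1 + 10 L\<^sup>4)\<close>, while \<open>\<delta>\<close> is exponentially
  small in \<open>L\<^sup>2 n\<close>.
\<close>
lemma no_delta_dependent_estimator:
  fixes \<sigma>1 \<sigma>2 L :: real
  assumes "0 < \<sigma>1" "\<sigma>1 \<le> \<sigma>2" "L \<ge> sqrt 2" "n > 0"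
  shows "\<not> delta_dependent_sub_Gaussian_estimator L (var_class (\<sigma>1\<^sup>2) (\<sigma>2\<^sup>2)) n
            (exp (1 - 5 * L\<^sup>2 * real n)) E"
proof
  define \<delta> where "\<delta> = exp (1 - 5 * L\<^sup>2 * real n)"
  assume E: "delta_dependent_sub_Gaussian_estimator L (var_class (\<sigma>1\<^sup>2) (\<sigma>2\<^sup>2)) n
            (exp (1 - 5 * L\<^sup>2 * real n)) E"
  have L0: "L > 0" using assms(3) by (smt (verit) real_sqrt_gt_zero)
  have L2: "L\<^sup>2 \<ge> 2" using assms(3) L0 by (metis real_sqrt_le_iff abs_of_pos real_sqrt_abs)
  have ln5: "5 * L\<^sup>2 * real n > 1"
    using mult_mono[of 10 "5 * L\<^sup>2" 1 "real n"] L2 assms(4) by linarith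
  hence \<delta>: "0 < \<delta>" "\<delta> < 1" by (auto simp: \<delta>_def)
  \<comment> \<open>The odds p / (1 - p). With standard deviation \<sigma>1 the mean is \<sigma>1 sqrt T, and the radius is
    \<sigma>1 sqrt (5 L^4), so any T > 5 L^4 separates the two means.\<close>
  define T where "T = 10 * L ^ 4"
  have T: "T > 0" using L0 by (simp add: T_def)
  define p where "p = T / (1 + T)"
  have p: "0 < p" "p < 1" "1 - p = 1 / (1 + T)"
    using T by (auto simp: p_def field_simps)
  define a where "a = \<sigma>1 * (1 + T) / sqrt T"
  have var: "a\<^sup>2 * (p * (1 - p)) = \<sigma>1\<^sup>2"
  proof -
    have "\<sigma>1\<^sup>2 * (1 + T)\<^sup>2 / T * (T / (1 + T) * (1 / (1 + T))) = \<sigma>1\<^sup>2"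
      using T by (simp add: power2_eq_square)
    thus ?thesis
      using T by (simp only: p(3)) (simp add: a_def p_def power_divide power_mult_distrib)
  qed
  have mean: "p * a = \<sigma>1 * sqrt T"
  proof -
    have "p * a = \<sigma>1 * (T / sqrt T)" using T by (simp add: a_def p_def)
    thus ?thesis using T by (simp add: real_div_sqrt)
  qed
  have sd: "dist_sd (two_point a p) = \<sigma>1" "dist_sd (two_point (-a) p) = \<sigma>1"
    using p var assms(1) by (simp_all add: dist_sd_def dist_variance_two_point)
  define rad where "rad = L * \<sigma>1 * sqrt ((1 + ln (1 / \<delta>)) / real n)"
  have "(1 + ln (1 / \<delta>)) / real n = 5 * L\<^sup>2"
    using assms(4) by (simp add: \<delta>_def ln_div)
  hence rad: "rad = \<sigma>1 * sqrt (5 * L ^ 4)"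
    using L0 by (simp add: rad_def real_sqrt_mult power4_eq_xxxx power2_eq_square)
  have "rad < \<sigma>1 * sqrt T"
    unfolding rad using assms(1) L0 by (intro mult_strict_left_mono real_sqrt_less_mono) (auto simp: T_def)
  hence rad_less: "rad < p * a" using mean by simp
  have Emeas: "E \<in> borel_measurable (real_pow n \<Otimes>\<^sub>M restrict_space borel {\<delta>..<1})"
    using E by (simp add: delta_dependent_sub_Gaussian_estimator_def \<delta>_def)
  have E1 [measurable]: "(\<lambda>x. E (x, \<delta>)) \<in> borel_measurable (real_pow n)"
    by (rule measurable_compose[OF measurable_Pair Emeas])
       (use \<delta> in \<open>auto simp: space_restrict_space\<close>)
  define z where "z = flips_sample n 0 (\<lambda>_. False)"
  have large: "exp (1 - 5 * L\<^sup>2 * real n) < (1 - p) ^ n"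
  proof -
    define x where "x = 5 * L\<^sup>2"
    have x: "x \<ge> 10" using L2 by (simp add: x_def)
    have "1 + T = 1 + 2 / 5 * x\<^sup>2" by (simp add: T_def x_def power_mult_distrib)
    \<comment> \<open>The cube is a lower bound for exp (x - 1) that grows fast enough to beat the quadratic 1 + T.\<close>
    also have "\<dots> < (1 + (x - 1) / 3) ^ 3"
    proof -
      have "(1 + (x - 1) / 3) ^ 3 = (x + 2) ^ 3 / 27" by (simp add: field_simps power3_eq_cube)
      moreover have "x * x\<^sup>2 \<ge> 10 * x\<^sup>2" using x by (intro mult_right_mono) auto
      moreover have "x\<^sup>2 \<ge> 100" using power_mono[of 10 x 2] x by simp
      moreover have "(x + 2) ^ 3 = x * x\<^sup>2 + 6 * x\<^sup>2 + 12 * x + 8"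
        by (simp add: power3_eq_cube power2_eq_square algebra_simps)
      ultimately show ?thesis using x by linarith
    qed
    also have "\<dots> \<le> exp ((x - 1) / 3) ^ 3"
      using x by (intro power_mono exp_ge_add_one_self) auto
    also have "\<dots> = exp (x - 1)" by (simp flip: exp_of_nat_mult)
    finally have "1 / exp (x - 1) < 1 / (1 + T)"
      using T by (intro divide_strict_left_mono) auto
    hence "exp (1 - x) < 1 - p" by (simp add: p(3) exp_diff)
    hence "exp (1 - x) ^ n < (1 - p) ^ n"
      using assms(4) by (intro power_strict_mono) auto
    moreover have "exp (1 - x * n) \<le> exp (1 - x) ^ n"
      using assms(4) by (simp flip: exp_of_nat_mult add: algebra_simps)
    ultimately show ?thesis by (simp add: x_def)
  qed
  have close: "\<bar>E (z, \<delta>) - p * b\<bar> \<le> rad" if b: "b = a \<or> b = -a" for b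
  proof (rule ccontr)
    assume far: "\<not> \<bar>E (z, \<delta>) - p * b\<bar> \<le> rad"
    let ?P = "two_point b p"
    have P: "?P \<in> var_class (\<sigma>1\<^sup>2) (\<sigma>2\<^sup>2)"
      using p assms b var by (intro two_point_in_var_class) (auto intro: power_mono)
    have sdP: "dist_sd ?P = \<sigma>1" using b sd by auto
    have meanP: "dist_mean ?P = p * b" using p by (simp add: dist_mean_two_point)
    have "measure (iid_law ?P n) {x \<in> space (iid_law ?P n). \<bar>E (x, \<delta>) - p * b\<bar> > rad} \<le> \<delta>"
      using bspec[OF bspec[OF conjunct2[OF E[unfolded delta_dependent_sub_Gaussian_estimator_def]] P], of \<delta>] \<delta>
      unfolding \<delta>_def[symmetric] sdP meanP rad_def by simp
    hence "measure_pmf.prob (coin_flips n p) {\<omega>. \<bar>E (flips_sample n b \<omega>, \<delta>) - p * b\<bar> > rad} \<le> \<delta>"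
      by (subst (asm) measure_iid_law_two_point) (use assms in auto)
    moreover have "measure_pmf.prob (coin_flips n p) {\<lambda>_. False} \<le>
        measure_pmf.prob (coin_flips n p) {\<omega>. \<bar>E (flips_sample n b \<omega>, \<delta>) - p * b\<bar> > rad}"
      using far by (intro measure_pmf.finite_measure_mono) (auto simp: z_def flips_sample_def)
    ultimately have "(1 - p) ^ n \<le> \<delta>"
      using p by (simp add: measure_pmf_single prob_no_success)
    with large show False by (simp add: \<delta>_def)
  qed
  from close[of a] close[of "-a"] rad_less show False by auto
qed

section \<open>One estimator for all error probabilities\<close>

text \<open>
  Compare the low-variance distribution \<open>P0 = two_point a p\<close> with the high-variance distribution
  \<open>P1 = two_point a q\<close>, where \<open>p / (1 - p) = c / n\<close> and \<open>q / (1 - q) = k / n\<close>, so that a sample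
  has at most \<open>c\<close> respectively \<open>k\<close> nonzero entries on average, whatever \<open>n\<close> is. Even at the smallest error probability
  \<open>\<delta>min\<close>, the estimator must be close to the mean of \<open>P0\<close> on the scale of the small standard
  deviation of \<open>P0\<close>, outside an event \<open>A0\<close> with \<open>P0\<close>-probability at most \<open>\<delta>min\<close>. On samples with at
  most \<open>2k\<close> nonzero entries the likelihood ratio is at most \<open>\<rho> = (k/c)^(2k)\<close>, and under \<open>P1\<close> such
  samples have probability at least \<open>1/2\<close>. With \<open>\<delta>min = 1/(4\<rho>)\<close> the estimator is thus close to the
  mean of \<open>P0\<close> with \<open>P1\<close>-probability at least \<open>1/4\<close>, whereas at error probability \<open>exp (-3) < 1/4\<close>
  it should be close to the mean of \<open>P1\<close>.

  The two means are far enough apart when \<open>k\<close> is large compared with \<open>L\<^sup>2\<close>: the mean of \<open>P1\<close> is \<open>sqrt k\<close>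
  times its standard deviation divided by \<open>sqrt n\<close>, and the radius at
  error probability \<open>exp (-3)\<close> is \<open>2 L\<close> times that unit. The choice \<open>k = 16 L\<^sup>2\<close> leaves half of the
  mean of \<open>P1\<close> as a gap, and the assumption \<open>sep\<close> says that \<open>c\<close> is so small that mean and radius of
  \<open>P0\<close> fit into it.
\<close>
lemma no_multiple_delta_estimator:
  fixes \<sigma>1 \<sigma>2 L c :: real
  assumes "0 < \<sigma>1" "L > 0" "n > 0" "0 < c"
  defines "k \<equiv> 16 * L\<^sup>2"
  defines "\<delta>min \<equiv> 1 / (4 * (k / c) powr (2 * k))"
  assumes "\<sigma>2 / \<sigma>1 > sqrt (k / c)" "c \<le> k" "c * (1 + k)\<^sup>2 \<le> k" "\<delta>min \<le> exp (-3)"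
    and sep: "(1 + k) * (c + L * sqrt (c * (1 + ln (1 / \<delta>min)))) < 8 * L\<^sup>2"
  shows "\<not> multiple_delta_sub_Gaussian_estimator L (var_class (\<sigma>1\<^sup>2) (\<sigma>2\<^sup>2)) n \<delta>min E"
proof
  assume E: "multiple_delta_sub_Gaussian_estimator L (var_class (\<sigma>1\<^sup>2) (\<sigma>2\<^sup>2)) n \<delta>min E"
  have [measurable]: "E \<in> borel_measurable (real_pow n)"
    using E by (simp add: multiple_delta_sub_Gaussian_estimator_def)
  have k: "k > 0" "sqrt k = 4 * L"
    using assms(2) by (auto simp: k_def real_sqrt_mult)
  have n: "real n \<ge> 1" using assms(3) by simp
  define N where "N = real n"
  have N: "N \<ge> 1" using n by (simp add: N_def)
  define C where "C = 1 + ln (1 / \<delta>min)"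
  define p where "p = c / (N + c)"
  define q where "q = k / (N + k)"
  have p: "0 < p" "p < 1" "p * (1 - p) = c * N / (N + c)\<^sup>2"
    using assms(4) N by (auto simp: p_def field_simps power2_eq_square)
  have q: "0 < q" "q < 1" "q * (1 - q) = k * N / (N + k)\<^sup>2"
    using k N by (auto simp: q_def field_simps power2_eq_square)
  define a where "a = \<sigma>1 / sqrt (p * (1 - p))"
  have a: "a > 0" using p(1,2) assms(1) by (simp add: a_def)
  have var0: "a\<^sup>2 * (p * (1 - p)) = \<sigma>1\<^sup>2"
    using p(1,2) by (simp add: a_def power_divide)
  \<comment> \<open>The variance ratio of P1 to P0 is (k / c) u^2. The bounds on u keep it between 1 and k / c
    for every sample size, so both distributions belong to the class.\<close>
  define u where "u = (N + c) / (N + k)"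
  have u: "0 < u" "u \<le> 1" "1 / (1 + k) \<le> u"
  proof -
    show "0 < u" "u \<le> 1" using assms(4,8) N k by (auto simp: u_def field_simps)
    have "k \<le> N * k" "0 < c * k" using N k assms(4) by simp_all
    hence "N + k \<le> (N + c) * (1 + k)"
      unfolding ring_distribs using assms(4) by linarith
    thus "1 / (1 + k) \<le> u" using N k by (simp add: u_def field_simps)
  qed
  have "q * (1 - q) = (k / c) * u\<^sup>2 * (p * (1 - p))"
    unfolding p q u_def using assms(4) N k by (simp add: power_divide)
  hence var1: "a\<^sup>2 * (q * (1 - q)) = \<sigma>1\<^sup>2 * (k / c * u\<^sup>2)"
    using var0 by (simp add: mult_ac)
  have "1 \<le> k / c * (1 / (1 + k))\<^sup>2"
    using assms(4,9) k by (simp add: power_divide field_simps)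
  also have "\<dots> \<le> k / c * u\<^sup>2"
    using u k assms(4) by (intro mult_left_mono power_mono) auto
  finally have var1_lower: "\<sigma>1\<^sup>2 \<le> a\<^sup>2 * (q * (1 - q))"
    using mult_left_mono[of 1 "k / c * u\<^sup>2" "\<sigma>1\<^sup>2"] by (simp add: var1)
  have "k / c * u\<^sup>2 \<le> k / c * 1"
    using u k assms(4) by (intro mult_left_mono power_le_one) auto
  also have "k / c * 1 = sqrt (k / c) ^ 2" using k assms(4) by simp
  also have "\<dots> \<le> (\<sigma>2 / \<sigma>1)\<^sup>2" using assms(7) k assms(4) by (intro power_mono) auto
  finally have "\<sigma>1\<^sup>2 * (k / c * u\<^sup>2) \<le> \<sigma>1\<^sup>2 * (\<sigma>2 / \<sigma>1)\<^sup>2"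
    by (rule mult_left_mono) simp
  also have "\<dots> = \<sigma>2\<^sup>2" using assms(1) by (simp add: power_divide)
  finally have var1_upper: "a\<^sup>2 * (q * (1 - q)) \<le> \<sigma>2\<^sup>2"
    unfolding var1 .
  have "1 \<le> sqrt (k / c)" using k assms(4,8) by simp
  hence "1 \<le> \<sigma>2 / \<sigma>1" using assms(7) by linarith
  hence "\<sigma>1 \<le> \<sigma>2" using assms(1) by simp
  hence P0: "two_point a p \<in> var_class (\<sigma>1\<^sup>2) (\<sigma>2\<^sup>2)"
    using p(1,2) var0 assms(1) by (intro two_point_in_var_class) (auto intro: power_mono)
  have P1: "two_point a q \<in> var_class (\<sigma>1\<^sup>2) (\<sigma>2\<^sup>2)"
    using q(1,2) var1_lower var1_upper by (intro two_point_in_var_class) auto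
  have sd: "dist_sd (two_point a s) = a * sqrt (t * N) / (N + t)"
    if "0 \<le> s" "s \<le> 1" "s * (1 - s) = t * N / (N + t)\<^sup>2" "0 < t" for s t
    using that a N unfolding dist_sd_def
    by (simp add: dist_variance_two_point real_sqrt_mult real_sqrt_divide)
  have radius: "L * dist_sd (two_point a s) * sqrt (D / real n) = L * a * sqrt (t * D) / (N + t)"
    if "0 \<le> s" "s \<le> 1" "s * (1 - s) = t * N / (N + t)\<^sup>2" "0 < t" for s t D
    using N by (subst sd[OF that]) (simp add: real_sqrt_mult real_sqrt_divide N_def)
  define F where "F = (\<lambda>\<omega>. E (flips_sample n a \<omega>))"
  have est: "measure_pmf.prob (coin_flips n s) {\<omega>. \<bar>F \<omega> - s * a\<bar> > L * a * sqrt (t * (1 + ln (1 / \<delta>))) / (N + t)} \<le> \<delta>"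
    if "\<delta>min \<le> \<delta>" "\<delta> < 1" "two_point a s \<in> var_class (\<sigma>1\<^sup>2) (\<sigma>2\<^sup>2)"
       "0 \<le> s" "s \<le> 1" "s * (1 - s) = t * N / (N + t)\<^sup>2" "0 < t" for s t \<delta>
  proof -
    let ?P = "two_point a s"
    have "measure (iid_law ?P n) {x \<in> space (iid_law ?P n).
            \<bar>E x - dist_mean ?P\<bar> > L * dist_sd ?P * sqrt ((1 + ln (1 / \<delta>)) / real n)} \<le> \<delta>"
      using E that(1-3) unfolding multiple_delta_sub_Gaussian_estimator_def by auto
    thus ?thesis
      using that(4,5) assms(3) unfolding radius[OF that(4-7)]
      by (subst (asm) measure_iid_law_two_point) (simp_all add: dist_mean_two_point F_def)
  qed
  define A0 where "A0 = {\<omega>. \<bar>F \<omega> - p * a\<bar> > L * a * sqrt (c * C) / (N + c)}"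
  define A1 where "A1 = {\<omega>. \<bar>F \<omega> - q * a\<bar> > 8 * L\<^sup>2 * a / (N + k)}"
  define B where "B = {\<omega>. real (card {i. i < n \<and> \<omega> i}) \<le> 2 * k}"
  have \<rho>: "(k / c) powr (2 * k) > 0" using k assms(4) by simp
  have A0: "measure_pmf.prob (coin_flips n p) A0 \<le> \<delta>min"
    unfolding A0_def C_def using assms(10) p assms(4)
    by (intro est P0) (auto intro: le_less_trans[OF _ exp_less_one_iff[THEN iffD2]])
  have "sqrt (k * (1 + ln (1 / exp (-3)))) = 8 * L"
    by (simp add: real_sqrt_mult k(2) ln_div)
  hence A1: "measure_pmf.prob (coin_flips n q) A1 \<le> exp (-3)"
    using est[of "exp (-3)" q k] assms(10) P1 q k by (simp add: A1_def power2_eq_square mult_ac)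
  have cover: "A0 \<union> A1 = UNIV"
  proof -
    have "(N + k) / (N + c) \<le> 1 + k"
    proof -
      have "k \<le> k * N" "0 < k * c" using N k assms(4) by simp_all
      hence "N + k \<le> (1 + k) * (N + c)"
        unfolding ring_distribs using assms(4) by linarith
      thus ?thesis using N assms(4) by (simp add: field_simps)
    qed
    moreover have "0 \<le> c + L * sqrt (c * C)"
    proof -
      have "\<delta>min \<le> 1" using assms(10) by (rule order_trans) simp
      hence "0 \<le> C" using \<rho> by (simp add: C_def \<delta>min_def)
      thus ?thesis using assms(2,4) by simp
    qed
    ultimately have "(N + k) / (N + c) * (c + L * sqrt (c * C)) < 8 * L\<^sup>2"
      using sep unfolding C_def by (rule le_less_trans[OF mult_right_mono])
    hence "(c + L * sqrt (c * C)) / (N + c) < 8 * L\<^sup>2 / (N + k)"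
      using N k by (simp add: field_simps)
    hence "(c + L * sqrt (c * C)) / (N + c) * a < 8 * L\<^sup>2 / (N + k) * a"
      using a by (rule mult_strict_right_mono)
    hence "p * a + L * a * sqrt (c * C) / (N + c) < q * a - 8 * L\<^sup>2 * a / (N + k)"
      by (simp add: p_def q_def k_def add_divide_distrib algebra_simps)
    thus ?thesis by (auto simp: A0_def A1_def)
  qed
  have "measure_pmf.prob (coin_flips n q) (A0 \<inter> B) \<le>
      (k / c) powr (2 * k) * measure_pmf.prob (coin_flips n p) A0"
  proof (rule prob_le_if_pmf_le[OF finite_set_pmf_coin_flips])
    show "pmf (coin_flips n q) \<omega> \<le> (k / c) powr (2 * k) * pmf (coin_flips n p) \<omega>" if "\<omega> \<in> B" for \<omega>
    proof (rule pmf_coin_flips_le)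
      show "p \<le> q" "q \<le> k / c * p" "1 \<le> k / c"
        using assms(4,8) N k by (auto simp: p_def q_def field_simps)
    qed (use that p q in \<open>auto simp: B_def\<close>)
  qed auto
  also have "\<dots> \<le> (k / c) powr (2 * k) * \<delta>min"
    using A0 by (intro mult_left_mono) auto
  also have "\<dots> = 1 / 4" using \<rho> by (simp add: \<delta>min_def)
  finally have A0B: "measure_pmf.prob (coin_flips n q) (A0 \<inter> B) \<le> 1 / 4" .
  have "measure_pmf.prob (coin_flips n q) (- B) \<le>
      measure_pmf.prob (coin_flips n q) {\<omega>. 2 * k \<le> real (card {i. i < n \<and> \<omega> i})}"
    by (intro measure_pmf.finite_measure_mono) (auto simp: B_def)
  also have "\<dots> \<le> N * q / (2 * k)"
    unfolding N_def using q k by (intro expected_successes_tail) auto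
  also have "N * q \<le> k"
    using N k by (simp add: q_def pos_divide_le_eq distrib_left mult.commute)
  hence "N * q / (2 * k) \<le> 1 / 2" using k by (simp add: divide_le_eq)
  finally have B: "measure_pmf.prob (coin_flips n q) (- B) \<le> 1 / 2" .
  have "1 = measure_pmf.prob (coin_flips n q) (A1 \<union> (A0 \<inter> B \<union> - B))"
    using cover by (subst (asm) Un_commute) (simp add: measure_pmf.prob_space_axioms Un_Int_distrib flip: Un_assoc)
  also have "\<dots> \<le> measure_pmf.prob (coin_flips n q) A1 +
      (measure_pmf.prob (coin_flips n q) (A0 \<inter> B) + measure_pmf.prob (coin_flips n q) (- B))"
    by (intro order_trans[OF measure_Un_le] add_left_mono measure_Un_le) auto
  also have "\<dots> \<le> exp (-3) + (1 / 4 + 1 / 2)"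
    using A1 A0B B by linarith
  finally have "exp (-3) \<ge> (1 / 4 :: real)" by simp
  moreover have "exp (3::real) > 4"
  proof -
    have "(2::real) ^ 3 \<le> exp 1 ^ 3" by (intro power_mono) (use exp_ge_add_one_self[of 1] in auto)
    thus ?thesis by (simp flip: exp_of_nat_mult)
  qed
  hence "exp (-3) < (1 / 4 :: real)" by (simp add: exp_minus field_simps)
  ultimately show False by simp
qed

text \<open>
  Although \<open>\<delta>min = 1 / (4 (k/c)^(2k))\<close> tends to \<open>0\<close> with \<open>c\<close>, the radius at \<open>\<delta>min\<close> vanishes in the limit: \<open>ln (1/\<delta>min)\<close>
  grows only like \<open>2k ln (1/c)\<close>, which is beaten by the factor \<open>c\<close> from the variance.
\<close>
lemma separation_parameter_exists:
  fixes k L M :: real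
  assumes "k > 0" "M > 0" "L > 0"
  shows "\<exists>c>0. c \<le> k \<and> c * (1 + k)\<^sup>2 \<le> k \<and> 1 / (4 * (k / c) powr (2 * k)) \<le> exp (-3) \<and>
     (1 + k) * (c + L * sqrt (c * (1 + ln (1 / (1 / (4 * (k / c) powr (2 * k))))))) < M"
proof -
  have "((\<lambda>c. 1 / (4 * (k / c) powr (2 * k))) \<longlongrightarrow> 0) (at_right 0)"
    using assms by real_asymp
  hence ev1: "\<forall>\<^sub>F c in at_right 0. 1 / (4 * (k / c) powr (2 * k)) < exp (-3)"
    by (rule order_tendstoD) simp
  have "((\<lambda>c. (1 + k) * (c + L * sqrt (c * (1 + ln (1 / (1 / (4 * (k / c) powr (2 * k)))))))) \<longlongrightarrow> 0) (at_right 0)"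
    using assms by real_asymp
  hence ev2: "\<forall>\<^sub>F c in at_right 0. (1 + k) * (c + L * sqrt (c * (1 + ln (1 / (1 / (4 * (k / c) powr (2 * k))))))) < M"
    by (rule order_tendstoD) fact
  have ev3: "\<forall>\<^sub>F c in at_right 0. c < k"
    using assms by real_asymp
  have "((\<lambda>c. c * (1 + k)\<^sup>2) \<longlongrightarrow> 0) (at_right 0)"
    using assms by real_asymp
  hence ev4: "\<forall>\<^sub>F c in at_right 0. c * (1 + k)\<^sup>2 < k"
    by (rule order_tendstoD) fact
  have "\<forall>\<^sub>F c in at_right (0::real). c > 0" by (simp add: eventually_at_right_less)
  with ev1 ev2 ev3 ev4 have "\<forall>\<^sub>F c in at_right 0. c > 0 \<and> c \<le> k \<and> c * (1 + k)\<^sup>2 \<le> k \<and>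
     1 / (4 * (k / c) powr (2 * k)) \<le> exp (-3) \<and>
     (1 + k) * (c + L * sqrt (c * (1 + ln (1 / (1 / (4 * (k / c) powr (2 * k))))))) < M"
    by eventually_elim auto
  thus ?thesis using eventually_happens trivial_limit_at_right_real by blast
qed

section \<open>Median of means\<close>

text \<open>
  The lower median as an order statistic. Expressed by counting, its sublevel sets are visibly
  measurable, and no sorting of the values is needed.
\<close>
definition lower_median :: "nat \<Rightarrow> (nat \<Rightarrow> real) \<Rightarrow> real" where
  "lower_median b y = Min (y ` {i. i < b \<and> b \<le> 2 * card {j. j < b \<and> y j \<le> y i}})"

lemma lower_median_le_iff:
  assumes "b > 0"
  shows "lower_median b y \<le> m \<longleftrightarrow> b \<le> 2 * card {j. j < b \<and> y j \<le> m}"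
proof -
  define S where "S = {i. i < b \<and> b \<le> 2 * card {j. j < b \<and> y j \<le> y i}}"
  have S_if: "\<exists>i\<in>S. y i \<le> m" if "b \<le> 2 * card {j. j < b \<and> y j \<le> m}" for m
  proof -
    let ?G = "{j. j < b \<and> y j \<le> m}"
    have "?G \<noteq> {}" using that assms by (metis card.empty mult_0_right not_le)
    moreover have "finite (y ` ?G)" by simp
    ultimately have "Max (y ` ?G) \<in> y ` ?G" by (intro Max_in) auto
    then obtain i where i: "i \<in> ?G" "Max (y ` ?G) = y i" by auto
    have "y j \<le> y i" if "j \<in> ?G" for j
      unfolding i(2)[symmetric] using that by (intro Max_ge) auto
    hence "?G \<subseteq> {j. j < b \<and> y j \<le> y i}" by blast
    hence "card ?G \<le> card {j. j < b \<and> y j \<le> y i}" by (intro card_mono) auto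
    thus ?thesis using i(1) that by (auto simp: S_def)
  qed
  have "S \<noteq> {}"
  proof -
    define m where "m = Max (y ` {..<b})"
    have "{j. j < b \<and> y j \<le> m} = {..<b}" by (auto simp: m_def)
    thus ?thesis using S_if[of m] by auto
  qed
  moreover have "finite S" by (simp add: S_def)
  ultimately have Min: "lower_median b y \<le> m \<longleftrightarrow> (\<exists>i\<in>S. y i \<le> m)"
    unfolding lower_median_def S_def[symmetric] by (subst Min_le_iff) auto
  have "b \<le> 2 * card {j. j < b \<and> y j \<le> m}" if "i \<in> S" "y i \<le> m" for i
  proof -
    have "card {j. j < b \<and> y j \<le> y i} \<le> card {j. j < b \<and> y j \<le> m}"
      using that(2) by (intro card_mono) auto
    thus ?thesis using that(1) by (simp add: S_def)
  qed
  with Min S_if show ?thesis by blast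
qed

text \<open>
  If fewer than half of the values are far from \<open>\<mu>\<close>, the values at most \<open>\<mu> + t\<close> form a majority,
  and those below \<open>\<mu> - t\<close> do not even form half.
\<close>
lemma lower_median_close:
  assumes "2 * card {j. j < b \<and> \<bar>y j - \<mu>\<bar> > t} < b"
  shows "\<bar>lower_median b y - \<mu>\<bar> \<le> t"
proof -
  have b: "b > 0" using assms by auto
  let ?bad = "{j. j < b \<and> \<bar>y j - \<mu>\<bar> > t}" and ?le = "\<lambda>m. {j. j < b \<and> y j \<le> m}"
  have "b = card (?bad \<union> {j. j < b \<and> \<bar>y j - \<mu>\<bar> \<le> t})"
  proof -
    have "?bad \<union> {j. j < b \<and> \<bar>y j - \<mu>\<bar> \<le> t} = {..<b}" by auto
    thus ?thesis by simp
  qed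
  also have "\<dots> \<le> card (?bad \<union> ?le (\<mu> + t))"
    by (intro card_mono) auto
  also have "\<dots> \<le> card ?bad + card (?le (\<mu> + t))" by (rule card_Un_le)
  finally have "lower_median b y \<le> \<mu> + t"
    using assms by (subst lower_median_le_iff[OF b]) linarith
  moreover have "\<mu> - t \<le> lower_median b y"
  proof (rule ccontr)
    assume less: "\<not> \<mu> - t \<le> lower_median b y"
    have "b \<le> 2 * card (?le (lower_median b y))"
      using lower_median_le_iff[OF b, of y "lower_median b y"] by simp
    also have "card (?le (lower_median b y)) \<le> card ?bad"
      using less by (intro card_mono) auto
    finally show False using assms by linarith
  qed
  ultimately show ?thesis by linarith
qed

lemma borel_measurable_lower_median [measurable]:
  assumes [measurable]: "\<And>j. Y j \<in> borel_measurable M"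
  shows "(\<lambda>x. lower_median b (\<lambda>j. Y j x)) \<in> borel_measurable M"
proof (cases "b = 0")
  case False
  show ?thesis
  proof (rule borel_measurableI_le)
    fix m
    have count: "real (card {j. j < b \<and> Y j x \<le> m}) = (\<Sum>j<b. indicator {..m} (Y j x))" for x
      by (simp add: indicator_def sum.If_cases Int_def)
    have eq: "b \<le> 2 * card {j. j < b \<and> Y j x \<le> m} \<longleftrightarrow> real b \<le> 2 * (\<Sum>j<b. indicator {..m} (Y j x))" for x
      unfolding count[symmetric] by auto
    show "{x \<in> space M. lower_median b (\<lambda>j. Y j x) \<le> m} \<in> sets M"
      using False by (simp only: lower_median_le_iff eq) measurable
  qed
qed (simp add: lower_median_def)

text \<open>
  Chernoff's method. Give each deviating variable the weight \<open>z = 2e\<close> and every other one the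
  weight \<open>1/z\<close>. The product of the weights is at least \<open>1\<close> when half of the variables deviate, and
  each factor has expectation at most \<open>1/z + z \<cdot> 1/(4e\<^sup>2) = 1/e\<close>. The value \<open>1/(4e\<^sup>2)\<close> for the single
  deviation probability is what makes the exponent exactly \<open>-b\<close>.
\<close>
lemma (in prob_space) majority_deviates_le:
  fixes Y :: "nat \<Rightarrow> 'a \<Rightarrow> real"
  assumes indep: "indep_vars (\<lambda>_. borel) Y {..<b}"
    and dev: "\<And>j. j < b \<Longrightarrow> prob {x \<in> space M. \<bar>Y j x - \<mu>\<bar> > t} \<le> 1 / (4 * (exp 1)\<^sup>2)"
  shows "prob {x \<in> space M. b \<le> 2 * card {j. j < b \<and> \<bar>Y j x - \<mu>\<bar> > t}} \<le> exp (- real b)"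
proof -
  define z :: real where "z = 2 * exp 1"
  have z: "z \<ge> 1" using exp_ge_add_one_self[of 1] by (simp add: z_def)
  define h where "h = (\<lambda>y. if \<bar>y - \<mu>\<bar> > t then z else 1 / z)"
  have h_pos: "0 < h y" for y using z by (simp add: h_def)
  have [measurable]: "h \<in> borel_measurable borel" unfolding h_def by measurable
  have Y [measurable]: "random_variable borel (Y j)" if "j < b" for j
    using indep that by (auto simp: indep_vars_def)
  have int: "integrable M (\<lambda>x. h (Y j x))" if "j < b" for j
  proof (rule integrable_const_bound[where B = z])
    show "AE x in M. norm (h (Y j x)) \<le> z"
      using z by (auto simp: h_def field_simps intro: order_trans[OF _ mult_mono[OF z z]])
  qed (use that in measurable)
  have indep_h: "indep_vars (\<lambda>_. borel) (\<lambda>j x. h (Y j x)) {..<b}"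
    by (rule indep_vars_compose2[OF indep]) simp
  have exp_h: "expectation (\<lambda>x. h (Y j x)) \<le> exp (-1)" if "j < b" for j
  proof -
    let ?A = "{x \<in> space M. \<bar>Y j x - \<mu>\<bar> > t}"
    have "?A \<in> events" using that by measurable
    hence ind: "integrable M (indicator ?A :: 'a \<Rightarrow> real)"
      by (rule integrable_real_indicator) (simp add: emeasure_eq_measure)
    have "expectation (\<lambda>x. h (Y j x)) \<le> expectation (\<lambda>x. 1 / z + z * indicator ?A x)"
    proof (rule integral_mono[OF int[OF that]])
      show "integrable M (\<lambda>x. 1 / z + z * indicator ?A x)"
        by (intro Bochner_Integration.integrable_add integrable_mult_right integrable_const ind)
    qed (use z in \<open>auto simp: h_def indicator_def\<close>)
    also have "\<dots> = 1 / z + z * prob ?A"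
      using ind \<open>?A \<in> events\<close> by (subst Bochner_Integration.integral_add) (auto simp: prob_space)
    also have "\<dots> \<le> 1 / z + z * (1 / (4 * (exp 1)\<^sup>2))"
      using z dev[OF that] by (intro add_left_mono mult_left_mono) auto
    also have "\<dots> = exp (-1)"
      by (simp add: z_def power2_eq_square exp_minus field_simps)
    finally show ?thesis .
  qed
  have "{x \<in> space M. b \<le> 2 * card {j. j < b \<and> \<bar>Y j x - \<mu>\<bar> > t}} \<subseteq>
        {x \<in> space M. 1 \<le> (\<Prod>j<b. h (Y j x))}"
  proof safe
    fix x assume le: "b \<le> 2 * card {j. j < b \<and> \<bar>Y j x - \<mu>\<bar> > t}"
    define s where "s = card {j. j < b \<and> \<bar>Y j x - \<mu>\<bar> > t}"
    have "card {j. j < b \<and> \<bar>Y j x - \<mu>\<bar> > t} + card {j. j < b \<and> \<not> \<bar>Y j x - \<mu>\<bar> > t} = b"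
    proof (subst card_Un_disjoint[symmetric])
      have "{j. j < b \<and> \<bar>Y j x - \<mu>\<bar> > t} \<union> {j. j < b \<and> \<not> \<bar>Y j x - \<mu>\<bar> > t} = {..<b}" by auto
      thus "card ({j. j < b \<and> \<bar>Y j x - \<mu>\<bar> > t} \<union> {j. j < b \<and> \<not> \<bar>Y j x - \<mu>\<bar> > t}) = b" by simp
    qed auto
    hence rest: "card {j. j < b \<and> \<not> \<bar>Y j x - \<mu>\<bar> > t} = b - s"
      unfolding s_def by linarith
    have "(\<Prod>j<b. h (Y j x)) = z ^ s * (1 / z) ^ card {j. j < b \<and> \<not> \<bar>Y j x - \<mu>\<bar> > t}"
      by (simp add: h_def prod.If_cases Int_def s_def)
    also note rest
    also have "(1 / z) ^ (b - s) \<ge> (1 / z) ^ s"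
      using z le by (intro power_decreasing) (auto simp: s_def)
    hence "z ^ s * (1 / z) ^ (b - s) \<ge> z ^ s * (1 / z) ^ s"
      using z by (intro mult_left_mono) auto
    also have "z ^ s * (1 / z) ^ s = 1" using z by (simp flip: power_mult_distrib)
    finally show "1 \<le> (\<Prod>j<b. h (Y j x))" .
  qed
  moreover have "(\<lambda>x. \<Prod>j<b. h (Y j x)) \<in> borel_measurable M"
    by (intro borel_measurable_prod) auto
  ultimately have "prob {x \<in> space M. b \<le> 2 * card {j. j < b \<and> \<bar>Y j x - \<mu>\<bar> > t}} \<le>
      prob {x \<in> space M. 1 \<le> (\<Prod>j<b. h (Y j x))}"
    by (intro finite_measure_mono) auto
  also have "\<dots> \<le> expectation (\<lambda>x. \<Prod>j<b. h (Y j x)) / 1"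
    using int h_pos by (intro integral_Markov_inequality_measure[where A = "{}"] indep_vars_integrable[OF _ indep_h])
      (auto intro!: AE_I2 prod_pos less_imp_le)
  also have "\<dots> = (\<Prod>j<b. expectation (\<lambda>x. h (Y j x)))"
    using int by (subst indep_vars_lebesgue_integral[OF _ indep_h]) auto
  also have "\<dots> \<le> (\<Prod>j<b. exp (-1))"
    using exp_h h_pos[THEN less_imp_le] by (intro prod_mono) auto
  also have "\<dots> = exp (- real b)" by (simp flip: exp_of_nat_mult)
  finally show ?thesis .
qed

lemma (in prob_space) second_moment_indep_sum:
  fixes Z :: "'i \<Rightarrow> 'a \<Rightarrow> real"
  assumes "finite J" "indep_vars (\<lambda>_. borel) Z J"
    and "\<And>i. i \<in> J \<Longrightarrow> integrable M (\<lambda>x. (Z i x)\<^sup>2)" "\<And>i. i \<in> J \<Longrightarrow> expectation (Z i) = 0"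
  shows "integrable M (\<lambda>x. (\<Sum>i\<in>J. Z i x)\<^sup>2) \<and>
         expectation (\<lambda>x. (\<Sum>i\<in>J. Z i x)\<^sup>2) = (\<Sum>i\<in>J. expectation (\<lambda>x. (Z i x)\<^sup>2))"
  using assms
proof (induction J rule: finite_induct)
  case (insert i J)
  have rv [measurable]: "random_variable borel (Z j)" if "j \<in> insert i J" for j
    using insert.prems(1) that by (auto simp: indep_vars_def)
  have IH: "integrable M (\<lambda>x. (\<Sum>i\<in>J. Z i x)\<^sup>2)"
    "expectation (\<lambda>x. (\<Sum>i\<in>J. Z i x)\<^sup>2) = (\<Sum>i\<in>J. expectation (\<lambda>x. (Z i x)\<^sup>2))"
    using insert.IH insert.prems indep_vars_subset[OF insert.prems(1), of J] by auto
  have int: "integrable M (Z j)" if "j \<in> insert i J" for j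
    by (rule square_integrable_imp_integrable[OF rv[OF that] insert.prems(2)[OF that]])
  have int_sum: "integrable M (\<lambda>x. \<Sum>i\<in>J. Z i x)" using int by auto
  have ind: "indep_var borel (Z i) borel (\<lambda>x. \<Sum>i\<in>J. Z i x)"
    using insert.hyps insert.prems(1) by (rule indep_vars_sum)
  have prod: "integrable M (\<lambda>x. Z i x * (\<Sum>i\<in>J. Z i x))"
    "expectation (\<lambda>x. Z i x * (\<Sum>i\<in>J. Z i x)) = 0"
    using indep_var_integrable[OF ind] indep_var_lebesgue_integral[OF ind] int int_sum insert.prems(3)
    by auto
  have eq: "(\<Sum>i\<in>insert i J. Z i x)\<^sup>2 = (Z i x)\<^sup>2 + 2 * (Z i x * (\<Sum>i\<in>J. Z i x)) + (\<Sum>i\<in>J. Z i x)\<^sup>2" for x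
    using insert.hyps by (simp add: power2_sum algebra_simps)
  show ?case
    unfolding eq using insert.hyps insert.prems(2) IH prod by (simp add: )
qed (simp add: prob_space)

lemma distr_coordinate_iid_law:
  assumes "real_distribution P" "i < n"
  shows "distr (iid_law P n) borel (\<lambda>x. x i) = P"
proof -
  interpret P: real_distribution P by fact
  have "distr (iid_law P n) P (\<lambda>x. x i) = P"
    unfolding iid_law_def using assms(2) by (intro distr_PiM_component) (auto intro: P.prob_space_axioms)
  moreover have "distr (iid_law P n) P (\<lambda>x. x i) = distr (iid_law P n) borel (\<lambda>x. x i)"
    by (intro distr_cong) auto
  ultimately show ?thesis by simp
qed

lemma sets_iid_law:
  assumes "real_distribution P"
  shows "sets (iid_law P n) = sets (real_pow n)"
proof -
  interpret P: real_distribution P by fact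
  show ?thesis unfolding iid_law_def by (intro sets_PiM_cong) simp_all
qed

lemma prob_space_iid_law:
  assumes "real_distribution P"
  shows "prob_space (iid_law P n)"
  unfolding iid_law_def using assms by (intro prob_space_PiM) (auto simp: real_distribution_def)

lemma indep_vars_coordinates_iid_law:
  assumes "real_distribution P"
  shows "prob_space.indep_vars (iid_law P n) (\<lambda>_. borel) (\<lambda>i x. x i) {..<n}"
proof (cases "n = 0")
  case False
  interpret prob_space "iid_law P n" using assms by (rule prob_space_iid_law)
  have comp: "random_variable borel (\<lambda>x. x i)" if "i \<in> {..<n}" for i
    using that by (subst measurable_cong_sets[OF sets_iid_law[OF assms] refl]) measurable
  have "distr (iid_law P n) (real_pow n) (\<lambda>x. \<lambda>i\<in>{..<n}. x i) = distr (iid_law P n) (iid_law P n) (\<lambda>x. x)"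
  proof (rule distr_cong)
    show "(\<lambda>i\<in>{..<n}. x i) = x" if "x \<in> space (iid_law P n)" for x
      using that by (simp add: iid_law_def space_PiM PiE_restrict)
  qed (simp_all add: sets_iid_law[OF assms])
  also have "\<dots> = iid_law P n" by simp
  also have "\<dots> = PiM {..<n} (\<lambda>i. distr (iid_law P n) borel (\<lambda>x. x i))"
    by (subst iid_law_def, rule PiM_cong) (auto simp: distr_coordinate_iid_law[OF assms])
  finally show ?thesis
    using False comp by (subst indep_vars_iff_distr_eq_PiM') auto
next
  case True
  interpret prob_space "iid_law P n" using assms by (rule prob_space_iid_law)
  have "indep_vars (\<lambda>_. borel) (\<lambda>i x. x i) {}" by (simp add: indep_vars_def indep_sets_def)
  thus ?thesis using True by simp
qed

definition block_mean :: "nat \<Rightarrow> (nat \<Rightarrow> real) \<Rightarrow> nat \<Rightarrow> real" where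
  "block_mean N x j = (\<Sum>i\<in>{j * N..<Suc j * N}. x i) / real N"

text \<open>
  Only the first \<open>b \<cdot> (n div b)\<close> entries of the sample enter \<open>median_of_means b n\<close>: equal block
  lengths are simpler, and as \<open>n \<le> 2 b (n div b)\<close> for \<open>b \<le> n\<close>, at most half of the sample is lost.
\<close>
definition median_of_means :: "nat \<Rightarrow> nat \<Rightarrow> (nat \<Rightarrow> real) \<Rightarrow> real" where
  "median_of_means b n x = lower_median b (block_mean (n div b) x)"

lemma block_subset:
  assumes "j < b" "b * N \<le> n"
  shows "{j * N..<Suc j * N} \<subseteq> {..<(n::nat)}"
proof -
  have "Suc j * N \<le> b * N" using assms(1) by (intro mult_right_mono) auto
  thus ?thesis using assms(2) by auto
qed

lemma indep_vars_block_mean: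
  assumes "real_distribution P" "b * N \<le> n"
  shows "prob_space.indep_vars (iid_law P n) (\<lambda>_. borel) (\<lambda>j x. block_mean N x j) {..<b}"
proof -
  interpret prob_space "iid_law P n" using assms(1) by (rule prob_space_iid_law)
  define J where "J = (\<lambda>j. {j * N..<Suc j * N})"
  have "disjoint_family_on J {..<b}"
  proof (unfold disjoint_family_on_def, safe)
    fix i j k assume "i \<noteq> j" "k \<in> J i" "k \<in> J j"
    hence "k div N = i" "k div N = j"
      by (auto simp: J_def mult.commute[of N] intro: div_nat_eqI)
    with \<open>i \<noteq> j\<close> show "k \<in> {}" by simp
  qed
  hence "indep_vars (\<lambda>j. PiM (J j) (\<lambda>_. borel)) (\<lambda>j x. restrict (\<lambda>i. x i) (J j)) {..<b}"
    using indep_vars_coordinates_iid_law[OF assms(1)] block_subset[OF _ assms(2)]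
    by (intro indep_vars_restrict) (auto simp: J_def)
  hence "indep_vars (\<lambda>_. borel) (\<lambda>j x. (\<lambda>y. (\<Sum>i\<in>J j. y i) / real N) (restrict (\<lambda>i. x i) (J j))) {..<b}"
    by (rule indep_vars_compose2) measurable
  thus ?thesis by (simp add: block_mean_def J_def)
qed

lemma block_mean_deviation:
  assumes P: "real_distribution P" "integrable P (\<lambda>x. x\<^sup>2)"
    and "j < b" "b * N \<le> n" "N > 0" "t > 0"
  shows "measure (iid_law P n) {x \<in> space (iid_law P n). \<bar>block_mean N x j - dist_mean P\<bar> > t}
         \<le> dist_variance P / (real N * t\<^sup>2)"
proof -
  interpret P: real_distribution P by fact
  interpret prob_space "iid_law P n" using P(1) by (rule prob_space_iid_law)
  define \<mu> where "\<mu> = dist_mean P"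
  define J where "J = {j * N..<Suc j * N}"
  have J: "J \<subseteq> {..<n}" "card J = N" "finite J"
    using block_subset[OF assms(3,4)] by (auto simp: J_def)
  have comp [measurable]: "random_variable borel (\<lambda>x. x i)" if "i \<in> J" for i
    using that J by (subst measurable_cong_sets[OF sets_iid_law[OF P(1)] refl]) (auto intro: measurable_component_singleton)
  have int_P: "integrable P (\<lambda>x. x)"
    using P.square_integrable_imp_integrable[of "\<lambda>x. x"] P(2) by simp
  hence int_sq_P: "integrable P (\<lambda>x. (x - \<mu>)\<^sup>2)"
    using P(2) by (simp add: power2_diff)
  have transfer: "integrable (iid_law P n) (\<lambda>x. f (x i)) \<longleftrightarrow> integrable P f"
                 "expectation (\<lambda>x. f (x i)) = integral\<^sup>L P f"
    if "i \<in> J" "f \<in> borel_measurable borel" for i and f :: "real \<Rightarrow> real"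
  proof -
    have "distr (iid_law P n) borel (\<lambda>x. x i) = P"
      using that(1) J by (intro distr_coordinate_iid_law P) auto
    thus "integrable (iid_law P n) (\<lambda>x. f (x i)) \<longleftrightarrow> integrable P f"
         "expectation (\<lambda>x. f (x i)) = integral\<^sup>L P f"
      using integrable_distr_eq[OF comp[OF that(1)] that(2)] integral_distr[OF comp[OF that(1)] that(2)]
      by simp_all
  qed
  have indep: "indep_vars (\<lambda>_. borel) (\<lambda>i x. x i - \<mu>) J"
    by (rule indep_vars_compose2[OF indep_vars_subset[OF indep_vars_coordinates_iid_law[OF P(1)] J(1)]]) simp
  have sum: "integrable (iid_law P n) (\<lambda>x. (\<Sum>i\<in>J. x i - \<mu>)\<^sup>2)"
    "expectation (\<lambda>x. (\<Sum>i\<in>J. x i - \<mu>)\<^sup>2) = N * dist_variance P"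
  proof -
    have "integral\<^sup>L P (\<lambda>y. y - \<mu>) = 0"
      using int_P P.prob_space by (simp add: \<mu>_def dist_mean_def)
    hence mean: "expectation (\<lambda>x. x i - \<mu>) = 0" if "i \<in> J" for i
      by (subst transfer(2)[OF that, of "\<lambda>y. y - \<mu>"]) simp_all
    have int: "integrable (iid_law P n) (\<lambda>x. (x i - \<mu>)\<^sup>2)" if "i \<in> J" for i
      by (subst transfer(1)[OF that, of "\<lambda>y. (y - \<mu>)\<^sup>2"]) (simp_all add: int_sq_P)
    have var: "expectation (\<lambda>x. (x i - \<mu>)\<^sup>2) = dist_variance P" if "i \<in> J" for i
      by (subst transfer(2)[OF that, of "\<lambda>y. (y - \<mu>)\<^sup>2"]) (simp_all add: dist_variance_def \<mu>_def)
    note * = second_moment_indep_sum[OF J(3) indep int mean]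
    show "integrable (iid_law P n) (\<lambda>x. (\<Sum>i\<in>J. x i - \<mu>)\<^sup>2)" using * by blast
    have "expectation (\<lambda>x. (\<Sum>i\<in>J. x i - \<mu>)\<^sup>2) = (\<Sum>i\<in>J. dist_variance P)"
      using * var by (simp cong: sum.cong)
    thus "expectation (\<lambda>x. (\<Sum>i\<in>J. x i - \<mu>)\<^sup>2) = N * dist_variance P"
      using J(2) by simp
  qed
  have scale: "\<bar>block_mean N x j - \<mu>\<bar> > t \<longleftrightarrow> \<bar>\<Sum>i\<in>J. x i - \<mu>\<bar> > N * t" for x
  proof -
    have "block_mean N x j - \<mu> = (\<Sum>i\<in>J. x i - \<mu>) / N"
      using J assms(5) unfolding block_mean_def J_def[symmetric] by (simp add: sum_subtractf diff_divide_distrib)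
    thus ?thesis using assms(5) by (simp add: abs_divide pos_less_divide_eq mult.commute)
  qed
  have square: "(N * t)\<^sup>2 \<le> s\<^sup>2" if "\<bar>s\<bar> > N * t" for s :: real
    using assms(6) power_mono[of "N * t" "\<bar>s\<bar>" 2] that by simp
  have "prob {x \<in> space (iid_law P n). \<bar>block_mean N x j - \<mu>\<bar> > t} \<le>
      prob {x \<in> space (iid_law P n). (\<Sum>i\<in>J. x i - \<mu>)\<^sup>2 \<ge> (N * t)\<^sup>2}"
  proof (rule finite_measure_mono)
    have "(\<lambda>x. (\<Sum>i\<in>J. x i - \<mu>)\<^sup>2) \<in> borel_measurable (iid_law P n)"
      using sum(1) by (rule borel_measurable_integrable)
    thus "{x \<in> space (iid_law P n). (\<Sum>i\<in>J. x i - \<mu>)\<^sup>2 \<ge> (N * t)\<^sup>2} \<in> events"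
      by measurable
  qed (use square in \<open>auto simp only: scale\<close>)
  also have "\<dots> \<le> expectation (\<lambda>x. (\<Sum>i\<in>J. x i - \<mu>)\<^sup>2) / (N * t)\<^sup>2"
    using sum(1) assms(5,6) by (intro integral_Markov_inequality_measure[where A = "{}"]) auto
  also have "\<dots> = dist_variance P / (real N * t\<^sup>2)"
    unfolding sum(2) using assms(5) by (simp add: power2_eq_square)
  finally show ?thesis by (simp add: \<mu>_def)
qed

lemma borel_measurable_median_of_means [measurable]:
  "median_of_means b n \<in> borel_measurable (real_pow n)"
proof -
  have "(\<lambda>x. block_mean (n div b) x j) \<in> borel_measurable (real_pow n)" if "j < b" for j
  proof -
    have "{j * (n div b)..<Suc j * (n div b)} \<subseteq> {..<n}"
      using that by (intro block_subset) auto
    thus ?thesis unfolding block_mean_def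
      by (intro borel_measurable_divide borel_measurable_sum measurable_component_singleton) auto
  qed
  hence "(\<lambda>x. if j < b then block_mean (n div b) x j else 0) \<in> borel_measurable (real_pow n)" for j
    by (cases "j < b") simp_all
  hence "(\<lambda>x. lower_median b (\<lambda>j. if j < b then block_mean (n div b) x j else 0)) \<in> borel_measurable (real_pow n)"
    by (rule borel_measurable_lower_median)
  moreover have "lower_median b (\<lambda>j. if j < b then y j else 0) = lower_median b y" for y
    unfolding lower_median_def by (intro arg_cong[where f = Min] image_cong) (auto cong: conj_cong)
  ultimately show ?thesis by (simp add: median_of_means_def[abs_def])
qed

text \<open>
  The radius makes Chebyshev's bound for a single block equal to \<open>1/(4e\<^sup>2)\<close> at worst, the
  probability that the majority bound asks for; a factor \<open>sqrt 2\<close> in it pays for \<open>n \<le> 2 b (n div b)\<close>.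
\<close>
lemma median_of_means_deviation:
  assumes P: "real_distribution P" "integrable P (\<lambda>x. x\<^sup>2)" "dist_variance P \<le> \<sigma>\<^sup>2" "0 < \<sigma>"
    and b: "0 < b" "b \<le> n"
  shows "measure (iid_law P n) {x \<in> space (iid_law P n).
           \<bar>median_of_means b n x - dist_mean P\<bar> > 2 * sqrt 2 * exp 1 * \<sigma> * sqrt (real b / real n)}
         \<le> exp (- real b)"
proof -
  interpret prob_space "iid_law P n" using P(1) by (rule prob_space_iid_law)
  define N where "N = n div b"
  define t where "t = 2 * sqrt 2 * exp 1 * \<sigma> * sqrt (real b / real n)"
  have N: "N > 0" "b * N \<le> n" using b by (auto simp: N_def div_greater_zero_iff)
  have "n = b * N + n mod b" by (simp add: N_def)
  moreover have "n mod b < b" using b by simp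
  moreover have "b \<le> b * N" using N by simp
  ultimately have "n \<le> 2 * (b * N)" by linarith
  hence nN: "real n \<le> 2 * (real N * real b)"
    unfolding of_nat_le_iff[symmetric, where 'a = real] by (simp add: mult.commute)
  have t: "t > 0" "t\<^sup>2 = 8 * (exp 1)\<^sup>2 * \<sigma>\<^sup>2 * (real b / real n)"
    using b P(4) by (auto simp: t_def power_mult_distrib)
  have "prob {x \<in> space (iid_law P n). \<bar>block_mean N x j - dist_mean P\<bar> > t} \<le> 1 / (4 * (exp 1)\<^sup>2)"
    if "j < b" for j
  proof -
    have "prob {x \<in> space (iid_law P n). \<bar>block_mean N x j - dist_mean P\<bar> > t} \<le> dist_variance P / (real N * t\<^sup>2)"
      using that N t by (intro block_mean_deviation P)
    also have "\<dots> \<le> \<sigma>\<^sup>2 / (real N * t\<^sup>2)"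
      using P(3) by (intro divide_right_mono) auto
    also have "\<dots> = real n / (8 * (exp 1)\<^sup>2 * (real N * real b))"
      unfolding t(2) using b P(4) N by simp
    also have "\<dots> \<le> 2 * (real N * real b) / (8 * (exp 1)\<^sup>2 * (real N * real b))"
      using nN by (intro divide_right_mono) auto
    also have "\<dots> = 1 / (4 * (exp 1)\<^sup>2)"
      using N b by simp
    finally show ?thesis .
  qed
  hence "prob {x \<in> space (iid_law P n). b \<le> 2 * card {j. j < b \<and> \<bar>block_mean N x j - dist_mean P\<bar> > t}} \<le> exp (- real b)"
    using indep_vars_block_mean[OF P(1) N(2)] by (intro majority_deviates_le)
  moreover have "prob {x \<in> space (iid_law P n). \<bar>median_of_means b n x - dist_mean P\<bar> > t} \<le>
     prob {x \<in> space (iid_law P n). b \<le> 2 * card {j. j < b \<and> \<bar>block_mean N x j - dist_mean P\<bar> > t}}"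
  proof (rule finite_measure_mono)
    have rv: "random_variable borel (\<lambda>x. block_mean N x j)" if "j < b" for j
      using indep_vars_block_mean[OF P(1) N(2)] that by (auto simp: indep_vars_def)
    have eq: "real (card {j. j < b \<and> \<bar>block_mean N x j - dist_mean P\<bar> > t}) =
          (\<Sum>j<b. indicator {y. \<bar>y - dist_mean P\<bar> > t} (block_mean N x j))" for x
      by (simp add: indicator_def sum.If_cases Int_def)
    have "b \<le> 2 * card {j. j < b \<and> \<bar>block_mean N x j - dist_mean P\<bar> > t} \<longleftrightarrow>
          real b \<le> 2 * (\<Sum>j<b. indicator {y. \<bar>y - dist_mean P\<bar> > t} (block_mean N x j))" for x
      unfolding eq[symmetric] by auto
    moreover have "(\<lambda>x. \<Sum>j<b. indicator {y. \<bar>y - dist_mean P\<bar> > t} (block_mean N x j) :: real) \<in> borel_measurable (iid_law P n)"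
      by (intro borel_measurable_sum measurable_compose[OF rv]) auto
    ultimately show "{x \<in> space (iid_law P n). b \<le> 2 * card {j. j < b \<and> \<bar>block_mean N x j - dist_mean P\<bar> > t}} \<in> events"
      by simp
  qed (use lower_median_close[where b = b and \<mu> = "dist_mean P" and t = t] in \<open>force simp: median_of_means_def N_def not_less[symmetric]\<close>)
  ultimately show ?thesis by (simp add: t_def)
qed

section \<open>Intersecting confidence intervals\<close>

text \<open>
  The intervals \<open>[m j - r j, m j + r j]\<close> for \<open>j = k, \<dots>, K\<close> intersect in the interval from
  \<open>common_lower\<close> to \<open>common_upper\<close>, empty if these are in the wrong order.
\<close>
definition common_lower :: "nat \<Rightarrow> (nat \<Rightarrow> real) \<Rightarrow> (nat \<Rightarrow> real) \<Rightarrow> nat \<Rightarrow> real" where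
  "common_lower K m r k = Max ((\<lambda>j. m j - r j) ` {k..K})"

definition common_upper :: "nat \<Rightarrow> (nat \<Rightarrow> real) \<Rightarrow> (nat \<Rightarrow> real) \<Rightarrow> nat \<Rightarrow> real" where
  "common_upper K m r k = Min ((\<lambda>j. m j + r j) ` {k..K})"

text \<open>
  Lepski's selection rule: intersect as many intervals as possible, starting from the last (in the
  application the widest and most reliable one), and return a point of the intersection.
\<close>
definition intersect_intervals :: "nat \<Rightarrow> (nat \<Rightarrow> real) \<Rightarrow> (nat \<Rightarrow> real) \<Rightarrow> real" where
  "intersect_intervals K r m = common_lower K m r (LEAST k. common_lower K m r k \<le> common_upper K m r k)"

text \<open>
  If all intervals from index \<open>k\<close> on contain \<open>\<mu>\<close>, they have a common point, so the selected index
  is at most \<open>k\<close>. The returned point then lies in interval \<open>k\<close>, as \<open>\<mu>\<close> does. The rule does not know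
  \<open>k\<close>; this is why one estimator serves all error probabilities at once.
\<close>
lemma intersect_intervals_close:
  assumes "k \<le> K" and cover: "\<And>j. j \<in> {k..K} \<Longrightarrow> \<bar>m j - \<mu>\<bar> \<le> r j"
  shows "\<bar>intersect_intervals K r m - \<mu>\<bar> \<le> 2 * r k"
proof -
  let ?lo = "common_lower K m r" and ?hi = "common_upper K m r"
  define l where "l = (LEAST k. ?lo k \<le> ?hi k)"
  have "m i - r i \<le> m j + r j" if "i \<in> {k..K}" "j \<in> {k..K}" for i j
    using cover[OF that(1)] cover[OF that(2)] by linarith
  hence consistent: "?lo k \<le> ?hi k"
    using assms(1) by (auto simp: common_lower_def common_upper_def)
  hence "l \<le> k" "?lo l \<le> ?hi l"
    unfolding l_def by (auto intro: Least_le LeastI)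
  moreover have "m k - r k \<le> ?lo l"
    unfolding common_lower_def using \<open>l \<le> k\<close> assms(1) by (intro Max_ge) auto
  moreover have "?hi l \<le> m k + r k"
    unfolding common_upper_def using \<open>l \<le> k\<close> assms(1) by (intro Min_le) auto
  moreover have "\<bar>m k - \<mu>\<bar> \<le> r k" using assms(1) by (intro cover) auto
  ultimately show ?thesis by (simp add: intersect_intervals_def l_def[symmetric])
qed

lemma borel_measurable_intersect_intervals [measurable]:
  assumes [measurable]: "\<And>j. (\<lambda>x. m j x) \<in> borel_measurable M"
  shows "(\<lambda>x. intersect_intervals K r (\<lambda>j. m j x)) \<in> borel_measurable M"
proof -
  have lo [measurable]: "(\<lambda>x. common_lower K (\<lambda>j. m j x) r k) \<in> borel_measurable M" for k
    unfolding common_lower_def by (rule borel_measurable_Max) auto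
  have hi [measurable]: "(\<lambda>x. common_upper K (\<lambda>j. m j x) r k) \<in> borel_measurable M" for k
    unfolding common_upper_def by (rule borel_measurable_Min) auto
  show ?thesis
    unfolding intersect_intervals_def
    by (rule measurable_compose_countable[OF lo]) measurable
qed

lemma sum_half_powers_le: "(\<Sum>j\<in>{k..K}. (1 / 2 :: real) ^ j) \<le> 2 * (1 / 2) ^ k"
proof (cases "k \<le> K")
  case True
  have "(\<Sum>j\<in>{k..K}. (1 / 2 :: real) ^ j) = 2 * (1 / 2) ^ k - (1 / 2) ^ K"
    using True by (induction rule: dec_induct) auto
  thus ?thesis by simp
qed simp

text \<open>
  Median-of-means estimators with error probabilities \<open>2^-j\<close>, \<open>j \<le> K\<close>, give confidence intervals
  of radius \<open>r j\<close> once the unknown standard deviation is replaced by its upper bound \<open>\<sigma>2\<close>. The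
  intervals from \<open>k\<close> on all contain the mean except with probability at most \<open>\<Sum>j\<ge>k. 2^-j = 2 \<cdot> 2^-k\<close>. For given
  \<open>\<delta>\<close>, take the least \<open>k\<close> with \<open>2 \<cdot> 2^-k \<le> \<delta>\<close>; then \<open>2^-k > \<delta>/4\<close>, which costs the factor
  \<open>sqrt (1 + 2 ln 2)\<close> in the radius and the factor \<open>4\<close> in the smallest admissible \<open>\<delta>\<close>. Replacing \<open>\<sigma>2\<close>
  by the actual standard deviation costs the factor \<open>\<sigma>2/\<sigma>1\<close>. Index \<open>0\<close> has no blocks and a meaningless
  median; it does no harm, since only the intervals from \<open>k \<ge> 1\<close> on have to contain the mean.
\<close>
lemma multiple_delta_estimator_exists:
  fixes \<sigma>1 \<sigma>2 :: real
  assumes "0 < \<sigma>1" "\<sigma>1 < \<sigma>2" "n > 0"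
  shows "\<exists>E. multiple_delta_sub_Gaussian_estimator
                   ((4 * exp 1 * sqrt (2 + 4 * ln 2)) * (\<sigma>2 / \<sigma>1))
                   (var_class (\<sigma>1\<^sup>2) (\<sigma>2\<^sup>2)) n (4 * exp (1 - real n / 2)) E"
proof -
  define b where "b = (\<lambda>k::nat. nat \<lceil>real k * ln 2\<rceil>)"
  define r where "r = (\<lambda>k::nat. 2 * sqrt 2 * exp 1 * \<sigma>2 * sqrt ((1 + real k * ln 2) / real n))"
  \<comment> \<open>For n \<ge> 2, K is the last index with 2^-K \<ge> exp (1 - n/2); up to it, the number of blocks is at most n / 2.\<close>
  define K where "K = nat \<lfloor>(real n / 2 - 1) / ln 2\<rfloor>"
  define E where "E = (\<lambda>x. intersect_intervals K r (\<lambda>k. median_of_means (b k) n x))"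
  have [measurable]: "E \<in> borel_measurable (real_pow n)"
    unfolding E_def by measurable
  have dev: "measure (iid_law P n) {x \<in> space (iid_law P n). \<bar>E x - dist_mean P\<bar> > 2 * r k} \<le> 2 * (1 / 2) ^ k"
    if P: "P \<in> var_class (\<sigma>1\<^sup>2) (\<sigma>2\<^sup>2)" and k: "1 \<le> k" "k \<le> K" for P k
  proof -
    have P': "real_distribution P" "integrable P (\<lambda>x. x\<^sup>2)" "dist_variance P \<le> \<sigma>2\<^sup>2"
      using P by (auto simp: var_class_def)
    interpret prob_space "iid_law P n" using P'(1) by (rule prob_space_iid_law)
    define bad where "bad = (\<lambda>j. {x \<in> space (iid_law P n). \<bar>median_of_means (b j) n x - dist_mean P\<bar> > r j})"
    have [measurable]: "(\<lambda>x. median_of_means (b j) n x) \<in> borel_measurable (iid_law P n)" for j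
      using borel_measurable_median_of_means by (subst measurable_cong_sets[OF sets_iid_law[OF P'(1)] refl])
    have bad_sets: "bad j \<in> events" for j unfolding bad_def by measurable
    have bad_prob: "prob (bad j) \<le> (1 / 2) ^ j" if j: "j \<in> {k..K}" for j
    proof -
      have j1: "j \<ge> 1" "j \<le> K" using j k by auto
      have "real j \<le> (real n / 2 - 1) / ln 2"
      proof -
        have "int j \<le> \<lfloor>(real n / 2 - 1) / ln 2\<rfloor>" using j1 by (simp add: K_def)
        thus ?thesis by (simp add: le_floor_iff)
      qed
      hence jn: "real j * ln 2 \<le> real n / 2 - 1" by (simp add: field_simps)
      have pos: "real j * ln 2 > 0" using j1 by simp
      have b_ge: "real j * ln 2 \<le> real (b j)" and b_less: "real (b j) < real j * ln 2 + 1"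
        using pos unfolding b_def by linarith+
      have b: "b j > 0" "b j \<le> n"
        using b_ge b_less pos jn by linarith+
      have "prob (bad j) \<le> prob {x \<in> space (iid_law P n).
           \<bar>median_of_means (b j) n x - dist_mean P\<bar> > 2 * sqrt 2 * exp 1 * \<sigma>2 * sqrt (real (b j) / real n)}"
      proof (rule finite_measure_mono)
        have "2 * sqrt 2 * exp 1 * \<sigma>2 * sqrt (real (b j) / real n) \<le> r j"
          unfolding r_def using assms b_less
          by (intro mult_left_mono real_sqrt_le_mono divide_right_mono) auto
        thus "bad j \<subseteq> {x \<in> space (iid_law P n).
           \<bar>median_of_means (b j) n x - dist_mean P\<bar> > 2 * sqrt 2 * exp 1 * \<sigma>2 * sqrt (real (b j) / real n)}"
          by (auto simp: bad_def)
      qed measurable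
      also have "\<dots> \<le> exp (- real (b j))"
        using P' assms b by (intro median_of_means_deviation) auto
      also have "\<dots> \<le> exp (- (real j * ln 2))" using b_ge by simp
      also have "\<dots> = (1 / 2) ^ j"
        by (simp add: exp_minus exp_of_nat_mult power_one_over inverse_eq_divide)
      finally show ?thesis .
    qed
    have "prob {x \<in> space (iid_law P n). \<bar>E x - dist_mean P\<bar> > 2 * r k} \<le> prob (\<Union>j\<in>{k..K}. bad j)"
    proof (rule finite_measure_mono)
      show "{x \<in> space (iid_law P n). \<bar>E x - dist_mean P\<bar> > 2 * r k} \<subseteq> (\<Union>j\<in>{k..K}. bad j)"
        using intersect_intervals_close[OF k(2), of "\<lambda>j. median_of_means (b j) n _" "dist_mean P" r]
        by (force simp: bad_def E_def not_less[symmetric])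
    qed (use bad_sets in auto)
    also have "\<dots> \<le> (\<Sum>j\<in>{k..K}. prob (bad j))"
      using bad_sets by (intro finite_measure_subadditive_finite) auto
    also have "\<dots> \<le> (\<Sum>j\<in>{k..K}. (1 / 2) ^ j)"
      by (intro sum_mono bad_prob)
    also have "\<dots> \<le> 2 * (1 / 2) ^ k" by (rule sum_half_powers_le)
    finally show ?thesis .
  qed
  show ?thesis
    unfolding multiple_delta_sub_Gaussian_estimator_def
  proof (intro exI[of _ E] conjI ballI)
    fix \<delta> P assume \<delta>: "\<delta> \<in> {4 * exp (1 - real n / 2)..<1}" and P: "P \<in> var_class (\<sigma>1\<^sup>2) (\<sigma>2\<^sup>2)"
    interpret prob_space "iid_law P n" using P by (intro prob_space_iid_law) (auto simp: var_class_def)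
    have "0 < 4 * exp (1 - real n / 2)" by simp
    hence \<delta>_pos: "0 < \<delta>" using \<delta> by (meson atLeastLessThan_iff less_le_trans)
    define l where "l = ln (1 / \<delta>)"
    have l: "l > 0" using \<delta> \<delta>_pos by (simp add: l_def)
    define k where "k = nat \<lceil>1 + l / ln 2\<rceil>"
    have "l / ln 2 > 0" using l by simp
    hence k: "1 + l / ln 2 \<le> real k" "real k < 2 + l / ln 2" unfolding k_def by linarith+
    hence kl: "ln 2 + l \<le> real k * ln 2" "real k * ln 2 < 2 * ln 2 + l"
      by (simp_all add: field_simps)
    have k1: "1 \<le> k" using k(1) \<open>l / ln 2 > 0\<close> by linarith
    have "ln (4 * exp (1 - real n / 2)) \<le> ln \<delta>"
      using \<delta> \<delta>_pos by (subst ln_le_cancel_iff) auto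
    moreover have "ln (4::real) = 2 * ln 2" using ln_realpow[of 2 2] by simp
    ultimately have "2 * ln 2 + l \<le> real n / 2 - 1"
      using \<delta>_pos by (simp add: l_def ln_mult ln_div)
    hence "real k \<le> (real n / 2 - 1) / ln 2"
      using kl(2) by (simp add: field_simps)
    hence kK: "k \<le> K" unfolding K_def by (simp add: le_nat_floor)
    have half: "2 * (1 / 2) ^ k \<le> \<delta>"
    proof -
      have "2 * (1 / 2) ^ k = exp (ln 2 - real k * ln 2)"
        by (simp add: exp_diff exp_of_nat_mult power_one_over)
      also have "\<dots> \<le> exp (- l)" using kl(1) by simp
      also have "\<dots> = \<delta>" using \<delta>_pos by (simp add: l_def ln_div)
      finally show ?thesis .
    qed
    have sd: "\<sigma>1 \<le> dist_sd P"
      using P assms(1) unfolding dist_sd_def by (intro real_le_rsqrt) (auto simp: var_class_def)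
    have "2 * r k \<le> ((4 * exp 1 * sqrt (2 + 4 * ln 2)) * (\<sigma>2 / \<sigma>1)) * dist_sd P * sqrt ((1 + l) / real n)"
    proof -
      have "1 + real k * ln 2 \<le> (1 + 2 * ln 2) * (1 + l)"
      proof -
        have "0 \<le> 2 * ln 2 * l" using l by simp
        moreover have "(1 + 2 * ln 2) * (1 + l) = 1 + l + 2 * ln 2 + 2 * ln 2 * l"
          by (simp add: algebra_simps)
        ultimately show ?thesis using kl(2) by linarith
      qed
      hence "2 * r k \<le> 2 * (2 * sqrt 2 * exp 1 * \<sigma>2 * sqrt ((1 + 2 * ln 2) * (1 + l) / real n))"
        unfolding r_def using assms
        by (intro mult_left_mono real_sqrt_le_mono divide_right_mono) auto
      also have "\<dots> = 4 * exp 1 * (sqrt 2 * sqrt (1 + 2 * ln 2)) * \<sigma>2 * sqrt ((1 + l) / real n)"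
        by (simp add: real_sqrt_mult real_sqrt_divide)
      also have "sqrt 2 * sqrt (1 + 2 * ln 2) = sqrt (2 + 4 * ln 2)"
        by (simp flip: real_sqrt_mult)
      also have "4 * exp 1 * sqrt (2 + 4 * ln 2) * \<sigma>2 * sqrt ((1 + l) / real n) \<le>
          4 * exp 1 * sqrt (2 + 4 * ln 2) * ((\<sigma>2 / \<sigma>1) * dist_sd P) * sqrt ((1 + l) / real n)"
      proof (intro mult_right_mono mult_left_mono)
        show "\<sigma>2 \<le> \<sigma>2 / \<sigma>1 * dist_sd P"
          using sd assms mult_left_mono[OF sd, of "\<sigma>2 / \<sigma>1"] by simp
      qed (use l in auto)
      finally show ?thesis by (simp add: mult.assoc)
    qed
    hence "prob {x \<in> space (iid_law P n). \<bar>E x - dist_mean P\<bar> >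
        ((4 * exp 1 * sqrt (2 + 4 * ln 2)) * (\<sigma>2 / \<sigma>1)) * dist_sd P * sqrt ((1 + l) / real n)} \<le>
      prob {x \<in> space (iid_law P n). \<bar>E x - dist_mean P\<bar> > 2 * r k}"
    proof (intro finite_measure_mono)
      have "E \<in> borel_measurable (iid_law P n)"
        using P by (subst measurable_cong_sets[OF sets_iid_law refl]) (auto simp: var_class_def)
      thus "{x \<in> space (iid_law P n). \<bar>E x - dist_mean P\<bar> > 2 * r k} \<in> events"
        by measurable
    qed auto
    also have "\<dots> \<le> 2 * (1 / 2) ^ k" by (rule dev[OF P k1 kK])
    also note half
    finally show "prob {x \<in> space (iid_law P n). \<bar>E x - dist_mean P\<bar> >
        4 * exp 1 * sqrt (2 + 4 * ln 2) * (\<sigma>2 / \<sigma>1) * dist_sd P * sqrt ((1 + ln (1 / \<delta>)) / real n)} \<le> \<delta>"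
      by (simp only: l_def)
  qed measurable
qed

section \<open>Existence and non-existence of sub-Gaussian estimators\<close>

theorem theorem3p2:
  shows "(\<forall>(\<sigma>1::real) (\<sigma>2::real) (n::nat). 0 < \<sigma>1 \<and> \<sigma>1 < \<sigma>2 \<and> n \<ge> 6 \<longrightarrow>
            (\<exists>E. multiple_delta_sub_Gaussian_estimator
                   ((4 * exp 1 * sqrt (2 + 4 * ln 2)) * (\<sigma>2 / \<sigma>1))
                   (var_class (\<sigma>1\<^sup>2) (\<sigma>2\<^sup>2)) n (4 * exp (1 - real n / 2)) E))
       \<and> (\<forall>L::real. L \<ge> sqrt 2 \<longrightarrow>
            (\<exists>(\<phi>::real) (\<delta>min::real). \<phi> > 0 \<and> 0 < \<delta>min \<and> \<delta>min < 1 \<and>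
               (\<forall>(\<sigma>1::real) (\<sigma>2::real) (n::nat).
                  0 < \<sigma>1 \<and> \<sigma>1 < \<sigma>2 \<and> \<sigma>2 / \<sigma>1 > \<phi> \<and> n > 0 \<longrightarrow>
                  \<not> (\<exists>E. multiple_delta_sub_Gaussian_estimator L
                           (var_class (\<sigma>1\<^sup>2) (\<sigma>2\<^sup>2)) n \<delta>min E))))
       \<and> (\<forall>(\<sigma>1::real) (\<sigma>2::real) (L::real) (n::nat).
            0 < \<sigma>1 \<and> \<sigma>1 \<le> \<sigma>2 \<and> L \<ge> sqrt 2 \<and> n > 0 \<longrightarrow>
            \<not> (\<exists>E. delta_dependent_sub_Gaussian_estimator L
                     (var_class (\<sigma>1\<^sup>2) (\<sigma>2\<^sup>2)) n (exp (1 - 5 * L\<^sup>2 * real n)) E))"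
proof (intro conjI allI impI)
  fix \<sigma>1 \<sigma>2 :: real and n :: nat
  assume "0 < \<sigma>1 \<and> \<sigma>1 < \<sigma>2 \<and> n \<ge> 6"
  thus "\<exists>E. multiple_delta_sub_Gaussian_estimator
                   ((4 * exp 1 * sqrt (2 + 4 * ln 2)) * (\<sigma>2 / \<sigma>1))
                   (var_class (\<sigma>1\<^sup>2) (\<sigma>2\<^sup>2)) n (4 * exp (1 - real n / 2)) E"
    by (intro multiple_delta_estimator_exists) auto
next
  fix L :: real
  assume "L \<ge> sqrt 2"
  moreover have "sqrt 2 > (0 :: real)" by simp
  ultimately have L: "L > 0" by linarith
  define k where "k = 16 * L\<^sup>2"
  have k: "k > 0" using L by (simp add: k_def)
  obtain c where c: "c > 0" "c \<le> k" "c * (1 + k)\<^sup>2 \<le> k"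
      "1 / (4 * (k / c) powr (2 * k)) \<le> exp (-3)"
      "(1 + k) * (c + L * sqrt (c * (1 + ln (1 / (1 / (4 * (k / c) powr (2 * k))))))) < 8 * L\<^sup>2"
    using separation_parameter_exists[of k "8 * L\<^sup>2" L] k L by auto
  define \<delta>min where "\<delta>min = 1 / (4 * (k / c) powr (2 * k))"
  have "sqrt (k / c) > 0" "0 < \<delta>min" using k c(1) by (simp_all add: \<delta>min_def)
  moreover have "\<delta>min < 1"
    unfolding \<delta>min_def by (rule le_less_trans[OF c(4)]) simp
  moreover have "\<not> (\<exists>E. multiple_delta_sub_Gaussian_estimator L (var_class (\<sigma>1\<^sup>2) (\<sigma>2\<^sup>2)) n \<delta>min E)"
    if "0 < \<sigma>1 \<and> \<sigma>1 < \<sigma>2 \<and> \<sigma>2 / \<sigma>1 > sqrt (k / c) \<and> n > 0" for \<sigma>1 \<sigma>2 :: real and n :: nat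
    using no_multiple_delta_estimator[of \<sigma>1 L n c \<sigma>2] that L c unfolding \<delta>min_def k_def by blast
  ultimately show "\<exists>(\<phi>::real) (\<delta>min::real). \<phi> > 0 \<and> 0 < \<delta>min \<and> \<delta>min < 1 \<and>
               (\<forall>(\<sigma>1::real) (\<sigma>2::real) (n::nat).
                  0 < \<sigma>1 \<and> \<sigma>1 < \<sigma>2 \<and> \<sigma>2 / \<sigma>1 > \<phi> \<and> n > 0 \<longrightarrow>
                  \<not> (\<exists>E. multiple_delta_sub_Gaussian_estimator L
                           (var_class (\<sigma>1\<^sup>2) (\<sigma>2\<^sup>2)) n \<delta>min E))"
    by (intro exI[of _ "sqrt (k / c)"] exI[of _ \<delta>min]) simp
next
  fix \<sigma>1 \<sigma>2 L :: real and n :: nat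
  assume "0 < \<sigma>1 \<and> \<sigma>1 \<le> \<sigma>2 \<and> L \<ge> sqrt 2 \<and> n > 0"
  thus "\<not> (\<exists>E. delta_dependent_sub_Gaussian_estimator L
                     (var_class (\<sigma>1\<^sup>2) (\<sigma>2\<^sup>2)) n (exp (1 - 5 * L\<^sup>2 * real n)) E)"
    using no_delta_dependent_estimator by blast
qed

end
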